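(* Let $n,\ell\geq 1$ be integers and $L,K\geq 0$. Let $\nu_{n,\ell}:\mathrm{pow}(\mathbb{R}^{(n+1)\times(n+1)})\times\mathbb{R}^\ell\to\mathbb{R}_+$ be an $L$-stable adjusted valuation and let $\rho$ be a $K$-stable point descriptor with image in $\mathbb{R}^\ell$. Let $\Psi$ be the local basepoint filtration functor generated by $\nu_{n,\ell}$ and $\rho$. Then for all integers $k\geq 0$ and all finite metric spaces $X,Y$, $$ \min_{R\in \mathcal{R}(X,Y)}\ \max_{(x_0,y_0)\in R}\mathcal{C}_{\Psi,k}(x_0,y_0)\leq 2L\cdot\max\{1,K\}\cdot d_{\mathrm{GH}}(X,Y).$$
   Context: $\mathbb{R}_+=[0,\infty)$. For a set $S$, $\mathrm{pow}(S)$ denotes the set of all finite non-empty subsets of $S$. $\mathcal{M}$ is the collection of all finite (non-empty) metric spaces. A correspondence between $X$ and $Y$ is a relation $R\subset X\times Y$ whose projections onto $X$ and $Y$ are surjective; $\mathcal{R}(X,Y)$ is the set of all correspondences. The distortion of a relation $R$ is $\mathrm{dis}(R)=\max_{(x,y),(x',y')\in R}|d_X(x,x')-d_Y(y,y')|$, and $d_{\mathrm{GH}}(X,Y)=\frac12\min_{R\in\mathcal{R}(X,Y)}\mathrm{dis}(R)$. Matrix spaces and $\mathbb{R}^\ell$ carry the $\ell_\infty$ norm, and $d_{\mathrm{H}}$ is the Hausdorff distance for the $\ell_\infty$ distance on $\mathbb{R}^{(n+1)\times(n+1)}$. A filtration on a finite set $X$ is a map $\phi:\mathrm{pow}(X)\to\mathbb{R}_+$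 with $\phi(\tau)\leq\phi(\sigma)$ for all $\tau\subset\sigma$. A basepoint filtration functor $\Psi$ assigns to each $X\in\mathcal{M}$ a family $\{\Psi_X(x_0)\}_{x_0\in X}$ where each $\Psi_X(x_0)$ is a filtration on $X$. Basepoint curvature set: for $X\in\mathcal{M}$, $x_0\in X$, $\sigma\in\mathrm{pow}(X)$, $\mathrm{K}_n(x_0,\sigma)=\{(d_X(x_i,x_j))_{i,j=0}^n : x_1,\dots,x_n\in\sigma\}\subset\mathbb{R}^{(n+1)\times(n+1)}$. A point descriptor $\rho$ with image in $\mathbb{R}^\ell$ assigns to each $X\in\mathcal{M}$ a function $\rho_X:X\to\mathbb{R}^\ell$; it is $K$-stable if for all $X,Y\in\mathcal{M}$ and every correspondence $R$ between $X$ and $Y$, $\max_{(x_0,y_0)\in R}\|\rho_X(x_0)-\rho_Y(y_0)\|_\infty\leq K\cdot\mathrm{dis}(R)$. An adjusted valuation (in this setting) is a map $\nu_{n,\ell}:\mathrm{pow}(\mathbb{R}^{(n+1)\times(n+1)})\times\mathbb{R}^\ell\to\mathbb{R}_+$ such that for each fixed $v\in\mathbb{R}^\ell$, $\nu_{n,\ell}(A,v)\geq\nu_{n,\ell}(B,v)$ whenever $B\subset A$. It is $L$-stable if $|\nu_{n,\ell}(A,v)-\nu_{n,\ell}(B,w)|\leq L\cdot\max\{d_{\mathrm{H}}(A,B),\|v-w\|_\infty\}$ for all $A,B,v,w$. The local basepoint filtration functor generated by $\nu_{n,\ell}$ and $\rho$ is $\Psi_X(x_0)(\sigma)=\nu_{n,\ell}(\mathrm{K}_n(x_0,\sigma),\rho_X(x_0))$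 for $X\in\mathcal{M}$, $x_0\in X$, $\sigma\in\mathrm{pow}(X)$. For a filtration $\phi$ on $X$, $\mathrm{dgm}_k^{\phi}(X)$ is the persistence diagram of the $k$-th simplicial homology (coefficients in a fixed field) of the nested complexes $\{\sigma\in\mathrm{pow}(X):\phi(\sigma)\leq t\}$, $t\geq0$. $d_{\mathrm{B}}$ is the bottleneck distance. The $k$-dimensional cost function $\mathcal{C}_{\Psi,k}:X\times Y\to\mathbb{R}_+$ is $\mathcal{C}_{\Psi,k}(x,y)=d_{\mathrm{B}}\big(\mathrm{dgm}_k^{\Psi_X(x)}(X),\mathrm{dgm}_k^{\Psi_Y(y)}(Y)\big)$. *)

theory Defs
  imports "HOL-Analysis.Analysis" "HOL-Library.Multiset" "HOL-Library.Function_Algebras"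
begin

section \<open>Finite metric spaces and the Gromov-Hausdorff distance\<close>

definition fin_pow :: "'a set \<Rightarrow> 'a set set" where
  "fin_pow S = {\<sigma>. \<sigma> \<subseteq> S \<and> finite \<sigma> \<and> \<sigma> \<noteq> {}}"

text \<open>The collection of all finite metric spaces is rendered as all finite non-empty metric
  spaces with points in a universe \<open>'a\<close>. The universe is an arbitrary type, so it can be chosen
  large enough to contain copies of any given spaces.\<close>

definition fin_metric_spaces :: "'a metric set" where
  "fin_metric_spaces = {X. finite (mspace X) \<and> mspace X \<noteq> {}}"

definition correspondences :: "'a metric \<Rightarrow> 'a metric \<Rightarrow> ('a \<times> 'a) set set" where
  "correspondences X Y =
     {R. R \<subseteq> mspace X \<times> mspace Y \<and> fst ` R = mspace X \<and> snd ` R = mspace Y}"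

definition distortion :: "'a metric \<Rightarrow> 'a metric \<Rightarrow> ('a \<times> 'a) set \<Rightarrow> real" where
  "distortion X Y R =
     (MAX ((x, y), (x', y')) \<in> R \<times> R. \<bar>mdist X x x' - mdist Y y y'\<bar>)"

definition gh_dist :: "'a metric \<Rightarrow> 'a metric \<Rightarrow> real" where
  "gh_dist X Y = 1/2 * (MIN R \<in> correspondences X Y. distortion X Y R)"


section \<open>Point descriptors, basepoint curvature sets and adjusted valuations\<close>

text \<open>Vectors in $R^\ell$ are \<open>real ^ 'l\<close> with \<open>CARD('l)\<close> equal to $\ell$. The indices
  $0, \dots, n$ of the rows and columns of an $(n+1) \times (n+1)$ matrix are the elements of
  \<open>'n option\<close> with \<open>CARD('n)\<close> equal to $n$, where \<open>None\<close> plays the role of the index $0$.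
  Types are non-empty, so $n, \ell \ge 1$. The library's \<open>infnorm\<close> is the norm $\ell_\infty$
  with respect to the standard basis; for matrices it is the largest absolute value of an entry.\<close>

type_synonym 'n dist_matrix = "((real, 'n option) vec, 'n option) vec"

definition hausdorff_dist :: "'v::euclidean_space set \<Rightarrow> 'v set \<Rightarrow> real" where
  "hausdorff_dist A B =
     max (MAX a \<in> A. MIN b \<in> B. infnorm (a - b)) (MAX b \<in> B. MIN a \<in> A. infnorm (a - b))"

definition curvature_set :: "'a metric \<Rightarrow> 'a \<Rightarrow> 'a set \<Rightarrow> ('n::finite) dist_matrix set" where
  "curvature_set X x0 \<sigma> =
     {(\<chi> i j. mdist X (case_option x0 x i) (case_option x0 x j)) | x :: 'n \<Rightarrow> 'a. range x \<subseteq> \<sigma>}"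

definition stable_descriptor :: "real \<Rightarrow> ('a metric \<Rightarrow> 'a \<Rightarrow> real ^ 'l) \<Rightarrow> bool" where
  "stable_descriptor K \<rho> \<longleftrightarrow>
     (\<forall>X \<in> fin_metric_spaces. \<forall>Y \<in> fin_metric_spaces. \<forall>R \<in> correspondences X Y.
        (MAX (x0, y0) \<in> R. infnorm (\<rho> X x0 - \<rho> Y y0)) \<le> K * distortion X Y R)"

definition adjusted_valuation ::
    "(('n::finite) dist_matrix set \<Rightarrow> real ^ 'l \<Rightarrow> real) \<Rightarrow> bool" where
  "adjusted_valuation \<nu> \<longleftrightarrow>
     (\<forall>A \<in> fin_pow UNIV. \<forall>v. 0 \<le> \<nu> A v) \<and>
     (\<forall>v. \<forall>A \<in> fin_pow UNIV. \<forall>B \<in> fin_pow UNIV. B \<subseteq> A \<longrightarrow> \<nu> A v \<ge> \<nu> B v)"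

definition stable_valuation ::
    "real \<Rightarrow> (('n::finite) dist_matrix set \<Rightarrow> real ^ 'l \<Rightarrow> real) \<Rightarrow> bool" where
  "stable_valuation L \<nu> \<longleftrightarrow>
     (\<forall>A \<in> fin_pow UNIV. \<forall>B \<in> fin_pow UNIV. \<forall>v w.
        \<bar>\<nu> A v - \<nu> B w\<bar> \<le> L * max (hausdorff_dist A B) (infnorm (v - w)))"


section \<open>Filtrations and basepoint filtration functors\<close>

definition is_filtration :: "'a set \<Rightarrow> ('a set \<Rightarrow> real) \<Rightarrow> bool" where
  "is_filtration X \<phi> \<longleftrightarrow>
     (\<forall>\<sigma> \<in> fin_pow X. 0 \<le> \<phi> \<sigma>) \<and>
     (\<forall>\<sigma> \<in> fin_pow X. \<forall>\<tau> \<in> fin_pow X. \<tau> \<subseteq> \<sigma> \<longrightarrow> \<phi> \<tau> \<le> \<phi> \<sigma>)"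

type_synonym 'a basepoint_functor = "'a metric \<Rightarrow> 'a \<Rightarrow> 'a set \<Rightarrow> real"

definition basepoint_filtration_functor :: "'a basepoint_functor \<Rightarrow> bool" where
  "basepoint_filtration_functor \<Psi> \<longleftrightarrow>
     (\<forall>X \<in> fin_metric_spaces. \<forall>x0 \<in> mspace X. is_filtration (mspace X) (\<Psi> X x0))"

definition local_functor ::
    "(('n::finite) dist_matrix set \<Rightarrow> real ^ 'l \<Rightarrow> real) \<Rightarrow>
     ('a metric \<Rightarrow> 'a \<Rightarrow> real ^ 'l) \<Rightarrow> 'a basepoint_functor" where
  "local_functor \<nu> \<rho> X x0 \<sigma> = \<nu> (curvature_set X x0 \<sigma>) (\<rho> X x0)"

lemma curvature_set_in_fin_pow:
  assumes "\<sigma> \<in> fin_pow S"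
  shows "(curvature_set X x0 \<sigma> :: ('n::finite) dist_matrix set) \<in> fin_pow UNIV"
proof -
  define F where "F = (\<lambda>x :: 'n \<Rightarrow> 'a.
    (\<chi> i j. mdist X (case_option x0 x i) (case_option x0 x j)) :: 'n dist_matrix)"
  have eq: "curvature_set X x0 \<sigma> = F ` {x. range x \<subseteq> \<sigma>}"
    by (auto simp: curvature_set_def F_def)
  have "{x :: 'n \<Rightarrow> 'a. range x \<subseteq> \<sigma>} = (UNIV \<rightarrow>\<^sub>E \<sigma>)"
    by (auto simp: PiE_def)
  moreover have "finite ((UNIV :: 'n set) \<rightarrow>\<^sub>E \<sigma>)"
    using assms by (intro finite_PiE) (auto simp: fin_pow_def)
  ultimately have "finite {x :: 'n \<Rightarrow> 'a. range x \<subseteq> \<sigma>}" by simp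
  moreover obtain s where "s \<in> \<sigma>" using assms by (auto simp: fin_pow_def)
  hence "(\<lambda>_. s) \<in> {x :: 'n \<Rightarrow> 'a. range x \<subseteq> \<sigma>}" by auto
  ultimately show ?thesis unfolding eq fin_pow_def by blast
qed

lemma curvature_set_mono: "\<tau> \<subseteq> \<sigma> \<Longrightarrow> curvature_set X x0 \<tau> \<subseteq> curvature_set X x0 \<sigma>"
  unfolding curvature_set_def by blast

lemma basepoint_filtration_functor_local:
  assumes "adjusted_valuation \<nu>"
  shows "basepoint_filtration_functor (local_functor \<nu> \<rho>)"
  using assms
  unfolding basepoint_filtration_functor_def is_filtration_def local_functor_def
    adjusted_valuation_def
  by (meson curvature_set_in_fin_pow curvature_set_mono)


section \<open>Simplicial homology with field coefficients\<close>

text \<open>An oriented \<open>k\<close>-chain on a simplicial complex \<open>K\<close> (a set of finite non-empty simplices,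
  closed under non-empty subsets) is an alternating, finitely supported function on the orderings
  $(v_0, \dots, v_k)$ of its \<open>k\<close>-simplices, extended by 0 to all other lists. The elementary chain
  $[v_0, \dots, v_k]$ takes the value \<open>1\<close> at $(v_0, \dots, v_k)$ and the sign of the permutation
  at its rearrangements.\<close>

definition chains :: "nat \<Rightarrow> 'a set set \<Rightarrow> ('a list \<Rightarrow> 'f::field) set" where
  "chains k K =
     {c. finite {xs. c xs \<noteq> 0} \<and>
         (\<forall>xs. c xs \<noteq> 0 \<longrightarrow> length xs = k + 1 \<and> distinct xs \<and> set xs \<in> K) \<and>
         (\<forall>xs i j. i < j \<and> j < length xs \<longrightarrow> c (xs[i := xs ! j, j := xs ! i]) = - c xs)}"

text \<open>On chains this is the linear extension of
  $\partial [v_0, \dots, v_k] = \sum_i (-1)^i [v_0, \dots, \widehat{v_i}, \dots, v_k]$: the coefficient of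
  $(v_0, \dots, \widehat{v_i}, \dots, v_k)$ is contributed by the list
  $(v_i, v_0, \dots, \widehat{v_i}, \dots, v_k)$, which differs from $(v_0, \dots, v_k)$ by a
  permutation of sign $(-1)^i$. The value at the empty list is 0 because the homology is not
  reduced.\<close>

definition boundary :: "('a list \<Rightarrow> 'f::field) \<Rightarrow> 'a list \<Rightarrow> 'f" where
  "boundary c ys = (if ys = [] then 0 else (\<Sum>v | c (v # ys) \<noteq> 0. c (v # ys)))"

definition cycles :: "nat \<Rightarrow> 'a set set \<Rightarrow> ('a list \<Rightarrow> 'f::field) set" where
  "cycles k K = {c \<in> chains k K. boundary c = (\<lambda>_. 0)}"

definition boundaries :: "nat \<Rightarrow> 'a set set \<Rightarrow> ('a list \<Rightarrow> 'f::field) set" where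
  "boundaries k K = boundary ` chains (k + 1) K"

definition chain_scale :: "'f::field \<Rightarrow> ('a list \<Rightarrow> 'f) \<Rightarrow> 'a list \<Rightarrow> 'f" where
  "chain_scale a c = (\<lambda>xs. a * c xs)"

interpretation chain_space: vector_space "chain_scale :: 'f::field \<Rightarrow> ('a list \<Rightarrow> 'f) \<Rightarrow> 'a list \<Rightarrow> 'f"
  by unfold_locales (auto simp: chain_scale_def fun_eq_iff algebra_simps)

text \<open>For finite complexes \<open>K \<subseteq> L\<close>, the rank of the map $H_k(K) \to H_k(L)$ induced by inclusion.
  Its image is $Z_k(K) / (Z_k(K) \cap B_k(L))$. The coefficient field is passed as a type.\<close>

definition persistent_betti :: "'f::field itself \<Rightarrow> nat \<Rightarrow> 'a set set \<Rightarrow> 'a set set \<Rightarrow> nat" where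
  "persistent_betti _ k K L =
     chain_space.dim (cycles k K :: ('a list \<Rightarrow> 'f) set)
     - chain_space.dim (cycles k K \<inter> boundaries k L :: ('a list \<Rightarrow> 'f) set)"


section \<open>Persistence diagrams and the bottleneck distance\<close>

definition sublevel :: "'a set \<Rightarrow> ('a set \<Rightarrow> real) \<Rightarrow> real \<Rightarrow> 'a set set" where
  "sublevel X \<phi> t = {\<sigma> \<in> fin_pow X. \<phi> \<sigma> \<le> t}"

definition strict_sublevel :: "'a set \<Rightarrow> ('a set \<Rightarrow> real) \<Rightarrow> real \<Rightarrow> 'a set set" where
  "strict_sublevel X \<phi> t = {\<sigma> \<in> fin_pow X. \<phi> \<sigma> < t}"

text \<open>The multiplicity of the point $(b, d)$, that is, of the interval $[b, d)$. If \<open>X\<close> is finite,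
  the strict sublevel complex at \<open>t\<close> is the sublevel complex at $t - \varepsilon$ for all small
  $\varepsilon > 0$. The multiplicity is therefore the usual alternating sum
  $\beta^{b, d - \varepsilon} - \beta^{b - \varepsilon, d - \varepsilon} - \beta^{b, d}
   + \beta^{b - \varepsilon, d}$ of persistent Betti numbers. The classes that never die have
  death time \<open>\<infinity>\<close>.\<close>

definition dgm_mult ::
    "'f::field itself \<Rightarrow> nat \<Rightarrow> 'a set \<Rightarrow> ('a set \<Rightarrow> real) \<Rightarrow> real \<Rightarrow> ereal \<Rightarrow> int" where
  "dgm_mult F k X \<phi> b d =
     (let \<beta> = \<lambda>K L. int (persistent_betti F k K L);
          at_b = sublevel X \<phi> b;
          before_b = strict_sublevel X \<phi> b
      in if d = \<infinity> then \<beta> at_b (fin_pow X) - \<beta> before_b (fin_pow X)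
         else let at_d = sublevel X \<phi> (real_of_ereal d);
                  before_d = strict_sublevel X \<phi> (real_of_ereal d)
              in \<beta> at_b before_d - \<beta> before_b before_d - \<beta> at_b at_d + \<beta> before_b at_d)"

text \<open>Off-diagonal points only. Births and finite deaths occur only at values of the filtration,
  all other multiplicities being 0.\<close>

definition dgm ::
    "'f::field itself \<Rightarrow> nat \<Rightarrow> 'a set \<Rightarrow> ('a set \<Rightarrow> real) \<Rightarrow> (real \<times> ereal) multiset" where
  "dgm F k X \<phi> =
     (\<Sum>(b, d) | b \<in> \<phi> ` fin_pow X \<and> d \<in> insert \<infinity> (ereal ` \<phi> ` fin_pow X) \<and> ereal b < d.
        replicate_mset (nat (dgm_mult F k X \<phi> b d)) (b, d))"

text \<open>The case distinction implements the convention $|\infty - \infty| = 0$, which fails in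
  \<open>ereal\<close>.\<close>

definition point_dist :: "real \<times> ereal \<Rightarrow> real \<times> ereal \<Rightarrow> ereal" where
  "point_dist p q =
     max (ereal \<bar>fst p - fst q\<bar>) (if snd p = snd q then 0 else \<bar>snd p - snd q\<bar>)"

text \<open>The $\ell_\infty$ distance to the diagonal.\<close>

definition diag_dist :: "real \<times> ereal \<Rightarrow> ereal" where
  "diag_dist p = (snd p - ereal (fst p)) / 2"

text \<open>A partial matching is the multiset of its matched pairs; the points left over on either
  side are matched to the diagonal. The bottleneck distance takes values in \<open>ereal\<close>, since
  diagrams with different numbers of points at infinity have distance \<open>\<infinity>\<close>.\<close>

definition partial_matchings :: "'p multiset \<Rightarrow> 'p multiset \<Rightarrow> ('p \<times> 'p) multiset set" where
  "partial_matchings P Q = {M. image_mset fst M \<subseteq># P \<and> image_mset snd M \<subseteq># Q}"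

definition matching_cost ::
    "(real \<times> ereal) multiset \<Rightarrow> (real \<times> ereal) multiset \<Rightarrow>
     ((real \<times> ereal) \<times> (real \<times> ereal)) multiset \<Rightarrow> ereal" where
  "matching_cost P Q M =
     Max (insert 0 ((\<lambda>(p, q). point_dist p q) ` set_mset M
       \<union> diag_dist ` set_mset (P - image_mset fst M)
       \<union> diag_dist ` set_mset (Q - image_mset snd M)))"

definition bottleneck_dist ::
    "(real \<times> ereal) multiset \<Rightarrow> (real \<times> ereal) multiset \<Rightarrow> ereal" where
  "bottleneck_dist P Q = (INF M \<in> partial_matchings P Q. matching_cost P Q M)"

definition cost ::
    "'f::field itself \<Rightarrow> 'a basepoint_functor \<Rightarrow> nat \<Rightarrow> 'a metric \<Rightarrow> 'a metric \<Rightarrow> 'a \<Rightarrow> 'a \<Rightarrow> ereal" where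
  "cost F \<Psi> k X Y x y =
     bottleneck_dist (dgm F k (mspace X) (\<Psi> X x)) (dgm F k (mspace Y) (\<Psi> Y y))"

end

(* For an optimal correspondence R, both filtrations are pulled back along the two projections to
   the vertex set R. This does not change the persistence diagrams, because points of R with the same
   image can be collapsed onto each other one at a time, and on R the two filtrations differ by at
   most L max(1, K) dis(R). Two filtrations on the same vertex set are joined by a straight line,
   along which the order of the simplices changes only finitely often. Between two such times both
   filtrations are monotone reparametrisations of a common one, so that the multiplicities of their
   diagrams are sums of common non-negative multiplicities, which gives an explicit matching. *)

theory Submission
  imports Defs
begin

text \<open>The two filtrations live on different vertex sets, so no simplex of \<open>X\<close> can
  be compared with one of \<open>Y\<close>. A simplex \<sigma> of \<open>R\<close> has an image in
  both spaces, and tuples in \<open>fst\<close> \<sigma>\<open>and\<close>snd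
  \<open>\<sigma>\<close> lift to tuples of pairs in \<sigma>; this is where the distortion enters.
  The collapse works because a pulled back complex that contains a simplex through \<open>v\<close>
  also contains that simplex with \<open>w\<close> added, whenever \<open>v\<close> and
  \<open>w\<close> have the same image. This gives an explicit chain homotopy on alternating
  functions. Multiplicities enter a diagram through \<open>nat\<close>, so they can be added up
  freely only once they are known to be non-negative; this follows from the modular law for
  dimensions of chain spaces. Subdividing the straight line loses nothing: the piece from
  \<open>s\<close> to \<open>t\<close> costs \<open>(t - s) * e\<close>, and the lengths of the
  pieces add up to 1. The factor 2 in the final bound cancels the 1/2 in
  \<open>gh_dist\<close>.\<close>

section \<open>Dimension formulas\<close>

context vector_space
begin

text \<open>Extend a basis \<open>B\<close> of the intersection to bases \<open>C\<close> of
  \<open>S\<close> and \<open>D\<close> of \<open>T\<close>; then \<open>C\<close> together with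
  \<open>D - B\<close> is a basis of the sum. Finite dimension enters through the finite set
  \<open>W\<close>, because the ambient space of all functions on lists need not have it, and
  \<open>dim\<close> is 0 for a space with an infinite basis.\<close>

lemma dim_sums_Int_finite:
  assumes "subspace S" "subspace T" "finite W" "S \<subseteq> span W" "T \<subseteq> span W"
  shows "dim {x + y |x y. x \<in> S \<and> y \<in> T} + dim (S \<inter> T) = dim S + dim T"
proof -
  obtain B where B: "B \<subseteq> S \<inter> T" "independent B" "S \<inter> T \<subseteq> span B" "card B = dim (S \<inter> T)"
    using basis_exists by metis
  obtain C where C: "B \<subseteq> C" "C \<subseteq> S" "independent C" "S \<subseteq> span C"
    using maximal_independent_subset_extend[of B S] B by blast
  obtain D where D: "B \<subseteq> D" "D \<subseteq> T" "independent D" "T \<subseteq> span D"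
    using maximal_independent_subset_extend[of B T] B by blast
  have fin: "finite C" "finite D"
    using independent_span_bound[OF assms(3)] C D assms(4,5) by (meson subset_trans)+
  have CD: "C \<inter> D \<subseteq> B"
  proof
    fix x assume x: "x \<in> C \<inter> D"
    show "x \<in> B"
    proof (rule ccontr)
      assume "x \<notin> B"
      then have "x \<in> span (C - {x})"
        using x B(3) C(1,2) D(2) span_mono[of B "C - {x}"] by blast
      then show False using C(3) x unfolding dependent_def by blast
    qed
  qed
  \<comment> \<open>If a new vector \<open>e\<close> of \<open>D - B\<close> were
    \<open>x + y\<close> with \<open>x\<close> in the span of \<open>C\<close> and \<open>y\<close>
    in that of \<open>E\<close>, then \<open>x = e - y\<close> would lie in both \<open>S\<close>
    and \<open>T\<close>, hence in the span of \<open>B\<close>. This contradicts the independence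
    of \<open>D\<close>.\<close>
  have ind: "independent (C \<union> E)" if "finite E" "E \<subseteq> D - B" for E
    using that
  proof (induction E rule: finite_induct)
    case empty
    then show ?case using C by simp
  next
    case (insert e E)
    have "e \<notin> span (C \<union> E)"
    proof
      assume "e \<in> span (C \<union> E)"
      then obtain x y where xy: "e = x + y" "x \<in> span C" "y \<in> span E"
        unfolding span_Un by blast
      have "y \<in> T" using xy(3) insert.prems D(2) span_minimal[OF _ assms(2), of E] by blast
      moreover have "e \<in> T" using insert.prems D(2) by blast
      ultimately have "e - y \<in> T" by (rule subspace_diff[OF assms(2), rotated])
      then have "x \<in> T" using xy(1) by simp
      moreover have "x \<in> S" using xy(2) C(2) span_minimal[OF _ assms(1)] by blast
      ultimately have "x \<in> span B" using B(3) by blast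
      then have "e \<in> span (B \<union> E)" using xy unfolding span_Un by blast
      then have "e \<in> span (D - {e})"
        using span_mono[of "B \<union> E" "D - {e}"] insert D(1) by blast
      then show False using D(3) insert.prems unfolding dependent_def by blast
    qed
    then show ?case using insert by (simp add: independent_insert)
  qed
  let ?E = "D - B"
  have "dim {x + y |x y. x \<in> S \<and> y \<in> T} = card (C \<union> ?E)"
  proof (rule dim_unique[OF _ _ _ refl])
    show "C \<union> ?E \<subseteq> {x + y |x y. x \<in> S \<and> y \<in> T}"
    proof
      fix x assume "x \<in> C \<union> ?E"
      then have "x + 0 = x" "0 + x = x" "x \<in> S \<or> x \<in> T" using C D by auto
      then show "x \<in> {x + y |x y. x \<in> S \<and> y \<in> T}"
        using subspace_0[OF assms(1)] subspace_0[OF assms(2)] by (smt (verit) mem_Collect_eq)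
    qed
    have "C \<union> D = C \<union> ?E" using C(1) by blast
    moreover have "{x + y |x y. x \<in> S \<and> y \<in> T} \<subseteq> span (C \<union> D)"
      using C(4) D(4) unfolding span_Un by blast
    ultimately show "{x + y |x y. x \<in> S \<and> y \<in> T} \<subseteq> span (C \<union> ?E)" by simp
    show "independent (C \<union> ?E)" using ind fin by blast
  qed
  moreover have "card (C \<union> ?E) = card C + card ?E"
    using fin CD by (intro card_Un_disjoint) auto
  moreover have "card ?E = card D - card B" "card B \<le> card D"
    using fin D(1) by (auto intro: card_Diff_subset card_mono finite_subset)
  moreover have "dim S = card C" "dim T = card D"
    using C D by (metis basis_card_eq_dim)+
  ultimately show ?thesis using B(4) by linarith
qed

lemma dim_mono_finite:
  assumes "finite W" "S \<subseteq> T" "T \<subseteq> span W"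
  shows "dim S \<le> dim T"
proof -
  obtain B where B: "B \<subseteq> S" "independent B" "S \<subseteq> span B" "card B = dim S"
    using basis_exists by metis
  obtain C where C: "B \<subseteq> C" "C \<subseteq> T" "independent C" "T \<subseteq> span C"
    using maximal_independent_subset_extend[of B T] B assms(2) by blast
  have "finite C" using independent_span_bound[OF assms(1) C(3)] C(2) assms(3) by blast
  then show ?thesis using B(4) C basis_card_eq_dim[OF C(2,4,3)] card_mono by metis
qed

end

text \<open>Injectivity is asked for on \<open>S\<close> only, since \<open>relabel\<close> is not
  injective on all functions: it forgets the values at lists that do not come from its vertex
  set.\<close>

lemma (in vector_space_pair) dim_linear_image:
  assumes "Vector_Spaces.linear s1 s2 f" "inj_on f S" "vs1.subspace S"
  shows "vs2.dim (f ` S) = vs1.dim S"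
proof -
  obtain B where B: "B \<subseteq> S" "vs1.independent B" "S \<subseteq> vs1.span B" "card B = vs1.dim S"
    using vs1.basis_exists by metis
  have SB: "vs1.span B = S" using vs1.span_subspace[OF B(1,3) assms(3)] .
  show ?thesis
  proof (rule vs2.dim_unique)
    show "f ` S \<subseteq> vs2.span (f ` B)"
      by (simp add: linear_span_image[OF assms(1)] SB)
    show "vs2.independent (f ` B)"
      using linear_independent_injective_image[OF assms(1) B(2)] assms(2) SB by simp
    show "card (f ` B) = vs1.dim S"
      using B(1,4) assms(2) by (metis card_image inj_on_subset)
  qed (use B in auto)
qed

section \<open>Alternating functions and the boundary operator\<close>

text \<open>Adjacent swaps generate all transpositions, so this agrees with the index-based
  condition in \<open>chains\<close>, and it can be used by splitting lists.\<close>

definition alternating :: "('a list \<Rightarrow> 'f::field) \<Rightarrow> bool" where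
  "alternating c \<longleftrightarrow> (\<forall>xs x y ys. c (xs @ x # y # ys) = - c (xs @ y # x # ys))"

lemma alternatingD: "alternating c \<Longrightarrow> c (xs @ x # y # ys) = - c (xs @ y # x # ys)"
  unfolding alternating_def by blast

text \<open>To exchange the ends across \<open>m # ms\<close>, move \<open>y\<close> past
  \<open>m\<close>, exchange across \<open>ms\<close>, and move \<open>m\<close> back past
  \<open>x\<close>: three changes of sign.\<close>

lemma alternating_swap:
  assumes "alternating c"
  shows "c (xs @ y # ms @ x # ys) = - c (xs @ x # ms @ y # ys)"
proof (induction ms arbitrary: xs)
  case Nil
  then show ?case using alternatingD[OF assms, of xs y x ys] by simp
next
  case (Cons m ms)
  show ?case
    using alternatingD[OF assms, of xs y m "ms @ x # ys"] Cons[of "xs @ [m]"]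
      alternatingD[OF assms, of xs m x "ms @ y # ys"] by simp
qed

lemma alternating_iff:
  "alternating c \<longleftrightarrow>
     (\<forall>xs i j. i < j \<and> j < length xs \<longrightarrow> c (xs[i := xs ! j, j := xs ! i]) = - c xs)"
proof (intro iffI allI impI)
  fix xs :: "'a list" and i j
  assume c: "alternating c" and ij: "i < j \<and> j < length xs"
  define as where "as = take i xs"
  define ms where "ms = take (j - Suc i) (drop (Suc i) xs)"
  define bs where "bs = drop (Suc j) xs"
  have l: "length as = i" "length ms = j - Suc i" using ij by (auto simp: as_def ms_def)
  define x y where "x = xs ! i" and "y = xs ! j"
  have "drop (Suc i) xs = ms @ y # bs"
    using ij id_take_nth_drop[of "j - Suc i" "drop (Suc i) xs"]
    by (simp add: ms_def bs_def y_def less_diff_conv)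
  then have xs: "xs = as @ x # ms @ y # bs"
    using ij id_take_nth_drop[of i xs] by (simp add: as_def x_def)
  have "i = length as" "j = length as + Suc (length ms)" using ij l by auto
  then have "xs[i := y, j := x] = as @ y # ms @ x # bs"
    unfolding xs by (simp add: list_update_append)
  then show "c (xs[i := xs ! j, j := xs ! i]) = - c xs"
    using alternating_swap[OF c, of as y ms x bs]
    unfolding x_def[symmetric] y_def[symmetric] by (simp add: xs[symmetric])
next
  assume *: "\<forall>xs i j. i < j \<and> j < length xs \<longrightarrow> c (xs[i := xs ! j, j := xs ! i]) = - c xs"
  show "alternating c" unfolding alternating_def
  proof (intro allI)
    fix xs x y and ys :: "'a list"
    show "c (xs @ x # y # ys) = - c (xs @ y # x # ys)"
      using *[rule_format, of "length xs" "Suc (length xs)" "xs @ y # x # ys"]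
      by (simp add: list_update_append nth_append)
  qed
qed

text \<open>The entry \<open>w\<close> passes \<open>length xs\<close> others. Identities between
  alternating functions can thus be checked on lists that begin with a chosen vertex.\<close>

lemma alternating_front:
  assumes "alternating c"
  shows "c (xs @ w # ys) = (-1) ^ length xs * c (w # xs @ ys)"
proof (induction xs arbitrary: ys rule: rev_induct)
  case (snoc x xs)
  have "c ((xs @ [x]) @ w # ys) = - c (xs @ w # x # ys)"
    using alternatingD[OF assms, of xs x w ys] by simp
  also have "\<dots> = (-1) ^ length (xs @ [x]) * c (w # (xs @ [x]) @ ys)"
    unfolding snoc[of "x # ys"] by simp
  finally show ?case .
qed simp

lemma alternating_front2:
  assumes "alternating c"
  shows "c (x # y # ys) = - c (y # x # ys)"
  using alternatingD[OF assms, of "[]" x y ys] by simp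

text \<open>Over a finite vertex set there are only finitely many lists of length
  \<open>k + 1\<close>, so finiteness of the support is automatic.\<close>

lemma in_chains_iff:
  assumes "finite V" "K \<subseteq> fin_pow V"
  shows "c \<in> chains k K \<longleftrightarrow>
     alternating c \<and> (\<forall>xs. c xs \<noteq> 0 \<longrightarrow> length xs = k + 1 \<and> distinct xs \<and> set xs \<in> K)"
proof -
  have "finite {xs. c xs \<noteq> 0}"
    if "\<forall>xs. c xs \<noteq> 0 \<longrightarrow> length xs = k + 1 \<and> distinct xs \<and> set xs \<in> K"
  proof (rule finite_subset)
    show "{xs. c xs \<noteq> 0} \<subseteq> {xs. set xs \<subseteq> V \<and> length xs = k + 1}"
      using that assms(2) unfolding fin_pow_def by blast
    show "finite {xs. set xs \<subseteq> V \<and> length xs = k + 1}"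
      using finite_lists_length_eq[OF assms(1)] .
  qed
  then show ?thesis unfolding chains_def alternating_iff by blast
qed

text \<open>Summing over a fixed vertex set instead of the support of \<open>c\<close> makes the
  operator linear on all functions, whereas \<open>boundary\<close> takes the value 0 at a list as
  soon as its index set is infinite.\<close>

definition boundary_on :: "'a set \<Rightarrow> ('a list \<Rightarrow> 'f::field) \<Rightarrow> 'a list \<Rightarrow> 'f" where
  "boundary_on V c ys = (if ys = [] then 0 else (\<Sum>v\<in>V. c (v # ys)))"

lemma boundary_eq_boundary_on:
  assumes "finite V" "K \<subseteq> fin_pow V" "c \<in> chains k K"
  shows "boundary c = boundary_on V c"
proof
  fix ys
  have "{v. c (v # ys) \<noteq> 0} \<subseteq> V"
    using assms(2,3) unfolding in_chains_iff[OF assms(1,2)] fin_pow_def by fastforce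
  then show "boundary c ys = boundary_on V c ys"
    unfolding boundary_def boundary_on_def
    using assms(1) by (auto intro!: sum.mono_neutral_left)
qed

lemma boundary_on_add: "boundary_on V (c + d) = boundary_on V c + boundary_on V d"
  by (auto simp: boundary_on_def fun_eq_iff sum.distrib)

lemma boundary_on_diff: "boundary_on V (c - d) = boundary_on V c - boundary_on V d"
  by (auto simp: boundary_on_def fun_eq_iff sum_subtractf)

lemma boundary_on_scale: "boundary_on V (chain_scale a c) = chain_scale a (boundary_on V c)"
  by (auto simp: boundary_on_def chain_scale_def fun_eq_iff sum_distrib_left)

lemma boundary_on_linear:
  "Vector_Spaces.linear chain_scale chain_scale (boundary_on V :: ('a list \<Rightarrow> 'f::field) \<Rightarrow> _)"
  unfolding Vector_Spaces.linear_iff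
  by (intro conjI chain_space.vector_space_axioms allI boundary_on_add boundary_on_scale)

lemma alternating_boundary_on: "alternating (boundary_on V c)" if "alternating c"
proof (unfold alternating_def, intro allI)
  note c = that
  fix xs x y ys
  have "(\<Sum>v\<in>V. c ((v # xs) @ x # y # ys)) = (\<Sum>v\<in>V. - c ((v # xs) @ y # x # ys))"
    by (intro sum.cong refl alternatingD[OF c])
  then show "boundary_on V c (xs @ x # y # ys) = - boundary_on V c (xs @ y # x # ys)"
    by (simp add: boundary_on_def sum_negf)
qed

text \<open>Stated with a vanishing diagonal so that it also holds in characteristic 2.\<close>

lemma sum_antisymmetric:
  fixes g :: "'a \<Rightarrow> 'a \<Rightarrow> 'f::ab_group_add"
  assumes "finite V" "\<And>u v. g u v = - g v u" "\<And>u. g u u = 0"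
  shows "(\<Sum>u\<in>V. \<Sum>v\<in>V. g u v) = 0"
  using assms(1)
proof (induction V rule: finite_induct)
  case (insert x V)
  have "(\<Sum>u\<in>V. g u x) = - (\<Sum>v\<in>V. g x v)"
    unfolding sum_negf[symmetric] by (intro sum.cong refl assms(2))
  then show ?case using insert assms(3) by (simp add: sum.distrib)
qed simp

text \<open>The vertices \<open>u\<close> and \<open>v\<close> are removed in both orders, with
  opposite signs; the terms with \<open>u = v\<close> vanish because the list repeats a
  vertex.\<close>

lemma boundary_on_boundary_on:
  assumes "finite V" "alternating c" "\<And>xs. c xs \<noteq> 0 \<Longrightarrow> distinct xs"
  shows "boundary_on V (boundary_on V c) = 0"
proof
  fix ys
  have "c (u # u # ys) = 0" for u using assms(3)[of "u # u # ys"] by auto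
  then have "(\<Sum>u\<in>V. \<Sum>v\<in>V. c (v # u # ys)) = 0"
    using alternating_front2[OF assms(2)] by (intro sum_antisymmetric[OF assms(1)])
  then show "boundary_on V (boundary_on V c) ys = 0 ys"
    by (simp add: boundary_on_def)
qed

section \<open>Chains as subspaces of a common finite-dimensional space\<close>

lemma subspace_chains:
  assumes "finite V" "K \<subseteq> fin_pow V"
  shows "chain_space.subspace (chains k K :: ('a list \<Rightarrow> 'f::field) set)"
  unfolding chain_space.subspace_def
proof (intro conjI ballI allI)
  fix b c :: "'a list \<Rightarrow> 'f"
  assume bc: "b \<in> chains k K" "c \<in> chains k K"
  have "b xs \<noteq> 0 \<or> c xs \<noteq> 0" if "(b + c) xs \<noteq> 0" for xs
    using that by auto
  then have "(b + c) xs \<noteq> 0 \<longrightarrow> length xs = k + 1 \<and> distinct xs \<and> set xs \<in> K" for xs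
    using bc unfolding in_chains_iff[OF assms] by blast
  moreover have "alternating (b + c)"
    unfolding alternating_def
  proof (intro allI)
    fix xs x y ys
    show "(b + c) (xs @ x # y # ys) = - (b + c) (xs @ y # x # ys)"
      using bc alternatingD[of b xs x y ys] alternatingD[of c xs x y ys]
      unfolding in_chains_iff[OF assms] by simp
  qed
  ultimately show "b + c \<in> chains k K" unfolding in_chains_iff[OF assms] by blast
next
  fix a :: 'f and c :: "'a list \<Rightarrow> 'f"
  assume c: "c \<in> chains k K"
  then have "alternating (chain_scale a c)"
    using alternatingD[of c] unfolding in_chains_iff[OF assms] alternating_def chain_scale_def
    by (metis mult_minus_right)
  then show "chain_scale a c \<in> chains k K"
    using c unfolding in_chains_iff[OF assms] chain_scale_def by simp
qed (simp add: in_chains_iff[OF assms] alternating_def)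

lemma sum_fun_apply: "sum f A x = (\<Sum>a\<in>A. f a x)"
  by (induction A rule: infinite_finite_induct) auto

text \<open>\<open>W\<close> consists of the indicator functions of single lists. They need not be
  chains, as only a bound on dimensions is wanted. \<open>W\<close> is chosen before
  \<open>K\<close>, so that nested complexes can share it.\<close>

lemma chains_in_finite_span:
  assumes "finite V"
  obtains W where "finite W" "\<And>K. K \<subseteq> fin_pow V \<Longrightarrow>
    (chains k K :: ('a list \<Rightarrow> 'f::field) set) \<subseteq> chain_space.span W"
proof
  let ?F = "{xs. set xs \<subseteq> V \<and> length xs = k + 1}"
  let ?e = "\<lambda>xs ys. if ys = xs then 1 else (0 :: 'f)"
  have fin: "finite ?F" by (rule finite_lists_length_eq[OF assms])
  then show "finite (?e ` ?F)" by simp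
  fix K assume K: "K \<subseteq> fin_pow V"
  show "(chains k K :: ('a list \<Rightarrow> 'f::field) set) \<subseteq> chain_space.span (?e ` ?F)"
  proof
    fix c :: "'a list \<Rightarrow> 'f" assume c: "c \<in> chains k K"
    have z: "c ys = 0" if "ys \<notin> ?F" for ys
      using c K that unfolding in_chains_iff[OF assms K] fin_pow_def by blast
    have "c = (\<Sum>xs\<in>?F. chain_scale (c xs) (?e xs))"
    proof
      fix ys
      have "(\<Sum>xs\<in>?F. chain_scale (c xs) (?e xs)) ys = (\<Sum>xs\<in>?F. if ys = xs then c xs else 0)"
        unfolding sum_fun_apply chain_scale_def by (intro sum.cong) auto
      also have "\<dots> = c ys" using z fin by (simp add: sum.delta')
      finally show "c ys = (\<Sum>xs\<in>?F. chain_scale (c xs) (?e xs)) ys" ..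
    qed
    also have "\<dots> \<in> chain_space.span (?e ` ?F)"
      by (intro chain_space.span_sum chain_space.span_scale chain_space.span_base) auto
    finally show "c \<in> chain_space.span (?e ` ?F)" .
  qed
qed

section \<open>Persistent Betti numbers\<close>

lemma chains_mono: "K \<subseteq> L \<Longrightarrow> chains k K \<subseteq> chains k L"
  unfolding chains_def by blast

lemma cycles_mono: "K \<subseteq> L \<Longrightarrow> cycles k K \<subseteq> cycles k L"
  unfolding cycles_def using chains_mono by blast

lemma boundaries_mono: "K \<subseteq> L \<Longrightarrow> boundaries k K \<subseteq> boundaries k L"
  unfolding boundaries_def using chains_mono by blast

lemma cycles_eq:
  assumes "finite V" "K \<subseteq> fin_pow V"
  shows "cycles k K = {c \<in> chains k K. boundary_on V c = 0}"
  unfolding cycles_def zero_fun_def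
  by (rule Collect_cong) (simp add: boundary_eq_boundary_on[OF assms] cong: conj_cong)

lemma boundaries_eq:
  assumes "finite V" "K \<subseteq> fin_pow V"
  shows "boundaries k K = boundary_on V ` chains (k + 1) K"
  unfolding boundaries_def by (intro image_cong refl boundary_eq_boundary_on[OF assms])

lemma boundary_on_0 [simp]: "boundary_on V 0 = 0"
  by (auto simp: boundary_on_def fun_eq_iff)

lemma subspace_cycles:
  assumes "finite V" "K \<subseteq> fin_pow V"
  shows "chain_space.subspace (cycles k K :: ('a list \<Rightarrow> 'f::field) set)"
proof -
  have "cycles k K = chains k K \<inter> {c :: 'a list \<Rightarrow> 'f. boundary_on V c = 0}"
    unfolding cycles_eq[OF assms] by blast
  moreover have "chain_space.subspace {c :: 'a list \<Rightarrow> 'f. boundary_on V c = 0}"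
    by (simp add: chain_space.subspace_def boundary_on_add boundary_on_scale)
  ultimately show ?thesis
    using chain_space.subspace_inter subspace_chains[OF assms] by metis
qed

lemma chain_space_pair: "vector_space_pair chain_scale chain_scale"
  by (intro vector_space_pair.intro chain_space.vector_space_axioms)

lemma subspace_boundaries:
  assumes "finite V" "K \<subseteq> fin_pow V"
  shows "chain_space.subspace (boundaries k K :: ('a list \<Rightarrow> 'f::field) set)"
  unfolding boundaries_eq[OF assms]
  by (rule vector_space_pair.linear_subspace_image
      [OF chain_space_pair boundary_on_linear subspace_chains[OF assms]])

lemma subspace_cycles_Int_boundaries:
  assumes "finite V" "K \<subseteq> fin_pow V" "L \<subseteq> fin_pow V"
  shows "chain_space.subspace (cycles k K \<inter> boundaries k L :: ('a list \<Rightarrow> 'f::field) set)"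
  using assms by (intro chain_space.subspace_inter subspace_cycles subspace_boundaries)

lemma cycles_in_finite_span:
  assumes "finite V"
  obtains W where "finite W" "\<And>K. K \<subseteq> fin_pow V \<Longrightarrow>
    (cycles k K :: ('a list \<Rightarrow> 'f::field) set) \<subseteq> chain_space.span W"
proof -
  obtain W where "finite W" "\<And>K. K \<subseteq> fin_pow V \<Longrightarrow>
    (chains k K :: ('a list \<Rightarrow> 'f::field) set) \<subseteq> chain_space.span W"
    by (rule chains_in_finite_span[OF assms, of k]) blast
  then show thesis using that[of W] unfolding cycles_def by blast
qed

text \<open>The subtraction of natural numbers in \<open>persistent_betti\<close> is never
  truncated, so alternating sums can be computed in the integers.\<close>

lemma int_persistent_betti:
  assumes "finite V" "K \<subseteq> fin_pow V"
  shows "int (persistent_betti TYPE('f::field) k K L) =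
    int (chain_space.dim (cycles k K :: ('a list \<Rightarrow> 'f) set))
    - int (chain_space.dim (cycles k K \<inter> boundaries k L :: ('a list \<Rightarrow> 'f) set))"
proof -
  obtain W where "finite W" "(cycles k K :: ('a list \<Rightarrow> 'f) set) \<subseteq> chain_space.span W"
    using cycles_in_finite_span[OF assms(1)] assms(2) by metis
  then have "chain_space.dim (cycles k K \<inter> boundaries k L :: ('a list \<Rightarrow> 'f) set)
      \<le> chain_space.dim (cycles k K :: ('a list \<Rightarrow> 'f) set)"
    by (intro chain_space.dim_mono_finite[of W]) auto
  then show ?thesis unfolding persistent_betti_def by simp
qed

text \<open>The sum of \<open>S\<close> and \<open>T\<close> still lies in \<open>U\<close>. Both
  inequalities between persistent Betti numbers below are instances.\<close>

lemma chain_space_submodular: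
  fixes S T U :: "('a list \<Rightarrow> 'f::field) set"
  assumes "finite W" "U \<subseteq> chain_space.span W" "chain_space.subspace S" "chain_space.subspace T"
    "chain_space.subspace U" "S \<subseteq> U" "T \<subseteq> U"
  shows "chain_space.dim S + chain_space.dim T \<le> chain_space.dim U + chain_space.dim (S \<inter> T)"
proof -
  have "{x + y |x y. x \<in> S \<and> y \<in> T} \<subseteq> U"
    using assms(6,7) chain_space.subspace_add[OF assms(5)] by blast
  then have "chain_space.dim {x + y |x y. x \<in> S \<and> y \<in> T} \<le> chain_space.dim U"
    by (rule chain_space.dim_mono_finite[OF assms(1) _ assms(2)])
  moreover have "S \<subseteq> chain_space.span W" "T \<subseteq> chain_space.span W" using assms(2,6,7) by auto
  ultimately show ?thesis
    using chain_space.dim_sums_Int_finite[OF assms(3,4,1)] by simp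
qed

text \<open>The quotient of \<open>Z(K')\<close> by its part in \<open>B(L)\<close> embeds into that
  of \<open>Z(K)\<close>. This yields non-negative multiplicities at infinity.\<close>

lemma persistent_betti_mono:
  assumes "finite V" "K' \<subseteq> K" "K \<subseteq> fin_pow V" "L \<subseteq> fin_pow V"
  shows "persistent_betti TYPE('f::field) k K' L \<le> persistent_betti TYPE('f) k K L"
proof -
  let ?Z = "\<lambda>K. cycles k K :: ('a list \<Rightarrow> 'f) set"
  let ?B = "\<lambda>K. boundaries k K :: ('a list \<Rightarrow> 'f) set"
  obtain W where W: "finite W" "?Z K \<subseteq> chain_space.span W"
    using cycles_in_finite_span[OF assms(1)] assms(3) by metis
  have m: "?Z K' \<subseteq> ?Z K" by (rule cycles_mono[OF assms(2)])
  have K': "K' \<subseteq> fin_pow V" using assms(2,3) by blast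
  have "chain_space.dim (?Z K') + chain_space.dim (?Z K \<inter> ?B L)
      \<le> chain_space.dim (?Z K) + chain_space.dim (?Z K' \<inter> (?Z K \<inter> ?B L))"
    by (intro chain_space_submodular[OF W] m subspace_cycles_Int_boundaries[OF assms(1,3,4)]
        subspace_cycles[OF assms(1,3)] subspace_cycles[OF assms(1) K'] Int_lower1)
  moreover have "?Z K' \<inter> (?Z K \<inter> ?B L) = ?Z K' \<inter> ?B L" using m by blast
  ultimately have "int (persistent_betti TYPE('f) k K' L) \<le> int (persistent_betti TYPE('f) k K L)"
    using assms K' by (simp add: int_persistent_betti[OF assms(1)])
  then show ?thesis by simp
qed

text \<open>The dimensions of \<open>Z(K)\<close> and \<open>Z(K')\<close> cancel. What remains is
  submodularity for \<open>Z(K') \<inter> B(L)\<close> and \<open>Z(K) \<inter> B(L')\<close> inside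
  \<open>Z(K) \<inter> B(L)\<close>, whose intersection is \<open>Z(K') \<inter> B(L')\<close>. This
  yields non-negative multiplicities at finite death times.\<close>

lemma persistent_betti_box:
  assumes "finite V" "K' \<subseteq> K" "K \<subseteq> fin_pow V" "L' \<subseteq> L" "L \<subseteq> fin_pow V"
  shows "persistent_betti TYPE('f::field) k K' L' + persistent_betti TYPE('f) k K L
    \<le> persistent_betti TYPE('f) k K L' + persistent_betti TYPE('f) k K' L"
proof -
  let ?Z = "\<lambda>K. cycles k K :: ('a list \<Rightarrow> 'f) set"
  let ?B = "\<lambda>K. boundaries k K :: ('a list \<Rightarrow> 'f) set"
  obtain W where W: "finite W" "?Z K \<inter> ?B L \<subseteq> chain_space.span W"
    using cycles_in_finite_span[OF assms(1)] assms(3) by (metis inf.coboundedI1)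
  have sub: "K' \<subseteq> fin_pow V" "L' \<subseteq> fin_pow V" using assms by auto
  have m: "?Z K' \<subseteq> ?Z K" "?B L' \<subseteq> ?B L"
    by (rule cycles_mono[OF assms(2)]) (rule boundaries_mono[OF assms(4)])
  have "chain_space.dim (?Z K' \<inter> ?B L) + chain_space.dim (?Z K \<inter> ?B L')
      \<le> chain_space.dim (?Z K \<inter> ?B L) + chain_space.dim ((?Z K' \<inter> ?B L) \<inter> (?Z K \<inter> ?B L'))"
    using assms sub m
    by (intro chain_space_submodular[OF W] subspace_cycles_Int_boundaries[OF assms(1)] Int_mono) auto
  moreover have "(?Z K' \<inter> ?B L) \<inter> (?Z K \<inter> ?B L') = ?Z K' \<inter> ?B L'" using m by blast
  ultimately have "int (persistent_betti TYPE('f) k K' L') + int (persistent_betti TYPE('f) k K L)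
    \<le> int (persistent_betti TYPE('f) k K L') + int (persistent_betti TYPE('f) k K' L)"
    using assms sub by (simp add: int_persistent_betti[OF assms(1)])
  then show ?thesis by simp
qed

section \<open>Removing a duplicate vertex\<close>

definition closed_complex :: "'a set set \<Rightarrow> bool" where
  "closed_complex K \<longleftrightarrow> (\<forall>\<sigma>\<in>K. \<forall>\<tau>. \<tau> \<subseteq> \<sigma> \<and> \<tau> \<noteq> {} \<longrightarrow> \<tau> \<in> K)"

lemma boundary_on_in_chains:
  assumes "finite V" "K \<subseteq> fin_pow V" "closed_complex K" "c \<in> chains (k + 1) K"
  shows "boundary_on V c \<in> chains k K"
proof -
  have "length ys = k + 1 \<and> distinct ys \<and> set ys \<in> K" if "boundary_on V c ys \<noteq> 0" for ys
  proof -
    have ne: "ys \<noteq> []" using that by (auto simp: boundary_on_def)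
    then have "(\<Sum>v\<in>V. c (v # ys)) \<noteq> 0" using that by (simp add: boundary_on_def)
    then obtain v where "c (v # ys) \<noteq> 0" by (rule sum.not_neutral_contains_not_neutral)
    then have "length (v # ys) = k + 1 + 1" "distinct (v # ys)" "set (v # ys) \<in> K"
      using assms(4) unfolding in_chains_iff[OF assms(1,2)] by blast+
    then show ?thesis
      using ne assms(3)[unfolded closed_complex_def, rule_format, of "set (v # ys)" "set ys"] by auto
  qed
  then show ?thesis
    using assms(4) alternating_boundary_on unfolding in_chains_iff[OF assms(1,2)] by blast
qed

text \<open>The chain homotopy for collapsing \<open>v\<close> onto \<open>w\<close>: it sends $[v, \dots]$ to $[w, v, \dots]$ and
  the simplices that do not contain \<open>v\<close>, or that contain \<open>w\<close> already, to 0.\<close>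

definition collapse_homotopy :: "'a \<Rightarrow> 'a \<Rightarrow> ('a list \<Rightarrow> 'f::field) \<Rightarrow> 'a list \<Rightarrow> 'f" where
  "collapse_homotopy v w c xs =
     (if w \<in> set xs \<and> v \<in> set (remove1 w xs) \<and> w \<notin> set (remove1 w xs)
      then (-1) ^ length (takeWhile (\<lambda>x. x \<noteq> w) xs) * c (remove1 w xs) else 0)"

text \<open>Computations with the homotopy split a list at its first \<open>w\<close>; the sign is
  that of moving this \<open>w\<close> to the front.\<close>

lemma collapse_homotopy_split:
  assumes "w \<notin> set xs"
  shows "collapse_homotopy v w c (xs @ w # ys) =
    (if v \<in> set (xs @ ys) \<and> w \<notin> set ys then (-1) ^ length xs * c (xs @ ys) else 0)"
proof -
  have "takeWhile (\<lambda>x. x \<noteq> w) (xs @ w # ys) = xs"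
    using assms by (subst takeWhile_append2) auto
  then show ?thesis
    using assms by (auto simp: collapse_homotopy_def remove1_append)
qed

lemma collapse_homotopy_eq_0: "w \<notin> set xs \<Longrightarrow> collapse_homotopy v w c xs = 0"
  by (simp add: collapse_homotopy_def)

text \<open>A swap away from the first \<open>w\<close> is passed on to \<open>c\<close>. A swap of
  that \<open>w\<close> with a neighbour leaves the list without \<open>w\<close> unchanged and
  shifts the position of \<open>w\<close> by one, which flips the sign. If both entries are
  \<open>w\<close>, the value is 0.\<close>

lemma alternating_collapse_homotopy:
  assumes "alternating c"
  shows "alternating (collapse_homotopy v w c)"
  unfolding alternating_def
proof (intro allI)
  fix xs x y ys
  let ?h = "collapse_homotopy v w c"
  consider (left) "w \<in> set xs" | (x) "w \<notin> set xs" "x = w" "y \<noteq> w" | (y) "w \<notin> set xs" "y = w" "x \<noteq> w"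
    | (both) "w \<notin> set xs" "x = w" "y = w"
    | (right) "w \<notin> set xs" "x \<noteq> w" "y \<noteq> w" "w \<in> set ys"
    | (none) "w \<notin> set xs" "x \<noteq> w" "y \<noteq> w" "w \<notin> set ys" by blast
  then show "?h (xs @ x # y # ys) = - ?h (xs @ y # x # ys)"
  proof cases
    case left
    then obtain as bs where xs: "xs = as @ w # bs" "w \<notin> set as"
      using split_list_first[of w xs] by blast
    show ?thesis
      using collapse_homotopy_split[OF xs(2), of v c "bs @ x # y # ys"]
        collapse_homotopy_split[OF xs(2), of v c "bs @ y # x # ys"]
        alternatingD[OF assms, of "as @ bs" x y ys]
      by (auto simp: xs(1))
  next
    case x
    then show ?thesis
      using collapse_homotopy_split[of w xs v c "y # ys"]
        collapse_homotopy_split[of w "xs @ [y]" v c ys] by auto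
  next
    case y
    then show ?thesis
      using collapse_homotopy_split[of w xs v c "x # ys"]
        collapse_homotopy_split[of w "xs @ [x]" v c ys] by auto
  next
    case both
    then show ?thesis using collapse_homotopy_split[of w xs v c "w # ys"] by simp
  next
    case right
    then obtain as bs where ys: "ys = as @ w # bs" "w \<notin> set as"
      using split_list_first[of w ys] by blast
    show ?thesis
      using right ys(2) collapse_homotopy_split[of w "xs @ x # y # as" v c bs]
        collapse_homotopy_split[of w "xs @ y # x # as" v c bs]
        alternatingD[OF assms, of xs x y "as @ bs"]
      by (auto simp: ys(1))
  next
    case none
    then show ?thesis by (simp add: collapse_homotopy_eq_0)
  qed
qed

lemma collapse_homotopy_in_chains:
  assumes "finite V" "K \<subseteq> fin_pow V" "c \<in> chains k K"
    and "\<And>\<sigma>. \<sigma> \<in> K \<Longrightarrow> v \<in> \<sigma> \<Longrightarrow> insert w \<sigma> \<in> K"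
  shows "collapse_homotopy v w c \<in> chains (k + 1) K"
proof -
  have "length xs = k + 1 + 1 \<and> distinct xs \<and> set xs \<in> K" if nz: "collapse_homotopy v w c xs \<noteq> 0" for xs
  proof -
    have "w \<in> set xs" using nz collapse_homotopy_eq_0 by metis
    then obtain as bs where xs: "xs = as @ w # bs" "w \<notin> set as"
      using split_list_first[of w xs] by blast
    have *: "v \<in> set (as @ bs)" "w \<notin> set bs" "c (as @ bs) \<noteq> 0"
      using nz unfolding xs(1) collapse_homotopy_split[OF xs(2)] by (auto split: if_splits)
    then have "length (as @ bs) = k + 1" "distinct (as @ bs)" "set (as @ bs) \<in> K"
      using assms(3) unfolding in_chains_iff[OF assms(1,2)] by blast+
    moreover have "set xs = insert w (set (as @ bs))" by (auto simp: xs(1))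
    ultimately show ?thesis
      using assms(4)[of "set (as @ bs)"] * xs by auto
  qed
  moreover have "alternating (collapse_homotopy v w c)"
    using assms(3) unfolding in_chains_iff[OF assms(1,2)] by (blast intro: alternating_collapse_homotopy)
  ultimately show ?thesis unfolding in_chains_iff[OF assms(1,2)] by simp
qed

text \<open>This removes the second term of the homotopy identity in two cases: for a cycle, whose
  boundary is 0, and for a chain whose boundary avoids \<open>v\<close>.\<close>

lemma collapse_homotopy_support:
  assumes "\<And>xs. v \<in> set xs \<Longrightarrow> c xs = 0"
  shows "collapse_homotopy v w c = 0"
  using assms by (auto simp: collapse_homotopy_def fun_eq_iff)

text \<open>With d the boundary and h the homotopy, this says dh + hd = id at all lists through
  \<open>v\<close>. If hd vanishes on \<open>c\<close>, then c - dhc is zero at these lists, so it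
  is a chain of the complex without \<open>v\<close>.\<close>

lemma collapse_homotopy_identity:
  assumes "finite V" "v \<noteq> w" "w \<in> V" "alternating c" "\<And>xs. c xs \<noteq> 0 \<Longrightarrow> distinct xs"
    and "v \<in> set xs"
  shows "boundary_on V (collapse_homotopy v w c) xs + collapse_homotopy v w (boundary_on V c) xs = c xs"
proof -
  let ?h = "collapse_homotopy v w"
  \<comment> \<open>All three functions are alternating, so it is enough to treat lists that begin
    with \<open>v\<close>. The cases are whether \<open>w\<close> occurs in \<open>ys\<close> not at
    all, more than once, or exactly once.\<close>
  have front: "boundary_on V (?h c) (v # ys) + ?h (boundary_on V c) (v # ys) = c (v # ys)" for ys
  proof (cases "w \<in> set ys")
    case False
    have "?h c (u # v # ys) = (if u = w then c (v # ys) else 0)" for u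
      using False assms(2) by (auto simp: collapse_homotopy_def)
    then have "boundary_on V (?h c) (v # ys) = c (v # ys)"
      using assms(1,3) by (simp add: boundary_on_def)
    moreover have "?h (boundary_on V c) (v # ys) = 0"
      using False assms(2) by (intro collapse_homotopy_eq_0) auto
    ultimately show ?thesis by simp
  next
    case True
    then obtain as bs where ys: "ys = as @ w # bs" "w \<notin> set as"
      using split_list_first[of w ys] by blast
    show ?thesis
    proof (cases "w \<in> set bs")
      case True
      have "\<not> distinct (v # ys)" using True ys by simp
      then have "c (v # ys) = 0" using assms(5) by blast
      moreover have "?h c' (v # ys) = 0" for c' :: "'a list \<Rightarrow> 'b"
        using collapse_homotopy_split[of w "v # as" v c' bs] True ys assms(2) by simp
      moreover have "?h c (u # v # ys) = 0" for u
        using collapse_homotopy_split[of w "u # v # as" v c bs]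
          collapse_homotopy_split[of w "[]" v c "v # ys"] True ys assms(2)
        by (cases "u = w") auto
      ultimately show ?thesis by (simp add: boundary_on_def)
    next
      case False
      \<comment> \<open>For \<open>u = w\<close> the list contains \<open>w\<close> twice, hence the
        value 0: exactly this term is missing in comparison with the boundary of
        \<open>c\<close>.\<close>
      have u: "?h c (u # v # ys) = (if u = w then 0 else (-1) ^ length as * c (u # v # as @ bs))" for u
        using collapse_homotopy_split[of w "u # v # as" v c bs]
          collapse_homotopy_split[of w "[]" v c "v # ys"] False ys assms(2)
        by (cases "u = w") auto
      have "boundary_on V (?h c) (v # ys) = (-1) ^ length as * (\<Sum>u\<in>V - {w}. c (u # v # as @ bs))"
        unfolding boundary_on_def sum_distrib_left
        by (simp add: u sum.remove[OF assms(1,3)])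
      \<comment> \<open>The minus sign arises because \<open>w\<close> is preceded by
        \<open>v # as\<close>, one entry more than \<open>as\<close>. The two sums therefore cancel
        up to the term \<open>u = w\<close>, which is the value of \<open>c\<close> once
        \<open>w\<close> is moved back into place.\<close>
      moreover have "?h (boundary_on V c) (v # ys) =
          - ((-1) ^ length as * (\<Sum>u\<in>V. c (u # v # as @ bs)))"
        using collapse_homotopy_split[of w "v # as" v "boundary_on V c" bs] False ys assms(2)
        by (simp add: boundary_on_def)
      moreover have "(\<Sum>u\<in>V. c (u # v # as @ bs)) = c (w # v # as @ bs) + (\<Sum>u\<in>V - {w}. c (u # v # as @ bs))"
        by (rule sum.remove[OF assms(1,3)])
      moreover have "c (v # ys) = - ((-1) ^ length as * c (w # v # as @ bs))"
        using alternating_front[OF assms(4), of "v # as" w bs] by (simp add: ys(1))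
      ultimately show ?thesis by (simp add: algebra_simps)
    qed
  qed
  obtain as bs where xs: "xs = as @ v # bs" using split_list[OF assms(6)] by blast
  have alt: "alternating (boundary_on V (?h c))" "alternating (?h (boundary_on V c))"
    using assms(4) by (simp_all add: alternating_boundary_on alternating_collapse_homotopy)
  show ?thesis
    unfolding xs alternating_front[OF alt(1)] alternating_front[OF alt(2)] alternating_front[OF assms(4)]
      distrib_left[symmetric] front ..
qed

lemma in_chains_avoiding:
  assumes "finite V" "K \<subseteq> fin_pow V"
  shows "c \<in> chains k {\<sigma> \<in> K. v \<notin> \<sigma>} \<longleftrightarrow> c \<in> chains k K \<and> (\<forall>xs. v \<in> set xs \<longrightarrow> c xs = 0)"
proof -
  have "{\<sigma> \<in> K. v \<notin> \<sigma>} \<subseteq> fin_pow V" using assms(2) by blast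
  then show ?thesis
    unfolding in_chains_iff[OF assms] in_chains_iff[OF assms(1) \<open>{\<sigma> \<in> K. v \<notin> \<sigma>} \<subseteq> fin_pow V\<close>] by blast
qed

text \<open>Two facts express that the complexes with and without \<open>v\<close> have the same
  persistent homology: cycles of \<open>K\<close> are cycles avoiding \<open>v\<close> up to
  boundaries, and a cycle avoiding \<open>v\<close> that bounds in \<open>L\<close> already bounds
  in \<open>L\<close> without \<open>v\<close>. The dimension formula for a sum turns them into an
  equality of ranks.\<close>

lemma persistent_betti_remove_duplicate:
  assumes fin: "finite V" and KL: "K \<subseteq> L" and LV: "L \<subseteq> fin_pow V"
    and cl: "closed_complex K" "closed_complex L"
    and vw: "v \<noteq> w" "w \<in> V"
    and insK: "\<And>\<sigma>. \<sigma> \<in> K \<Longrightarrow> v \<in> \<sigma> \<Longrightarrow> insert w \<sigma> \<in> K"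
    and insL: "\<And>\<sigma>. \<sigma> \<in> L \<Longrightarrow> v \<in> \<sigma> \<Longrightarrow> insert w \<sigma> \<in> L"
  shows "persistent_betti TYPE('f::field) k {\<sigma> \<in> K. v \<notin> \<sigma>} {\<sigma> \<in> L. v \<notin> \<sigma>} = persistent_betti TYPE('f) k K L"
proof -
  let ?K = "{\<sigma> \<in> K. v \<notin> \<sigma>}" and ?L = "{\<sigma> \<in> L. v \<notin> \<sigma>}"
  let ?Z = "\<lambda>K. cycles k K :: ('a list \<Rightarrow> 'f) set"
  let ?B = "\<lambda>K. boundaries k K :: ('a list \<Rightarrow> 'f) set"
  let ?h = "collapse_homotopy v w :: ('a list \<Rightarrow> 'f) \<Rightarrow> _"
  let ?d = "boundary_on V :: ('a list \<Rightarrow> 'f) \<Rightarrow> _"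
  have KV: "K \<subseteq> fin_pow V" and K'V: "?K \<subseteq> fin_pow V" and L'V: "?L \<subseteq> fin_pow V"
    using KL LV by auto
  have h: "?h c \<in> chains (j + 1) M" and dh: "?d (?h c) \<in> chains j M"
    and id: "v \<in> set xs \<Longrightarrow> ?d (?h c) xs + ?h (?d c) xs = c xs"
    if "c \<in> chains j M" "M = K \<or> M = L" for c j M xs
  proof -
    have M: "M \<subseteq> fin_pow V" "closed_complex M" using that(2) KV LV cl by auto
    show 1: "?h c \<in> chains (j + 1) M"
      using that insK insL by (intro collapse_homotopy_in_chains[OF fin M(1)]) auto
    show "?d (?h c) \<in> chains j M" by (rule boundary_on_in_chains[OF fin M 1])
    show "?d (?h c) xs + ?h (?d c) xs = c xs" if "v \<in> set xs"
      using \<open>c \<in> chains j M\<close> that vw unfolding in_chains_iff[OF fin M(1)]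
      by (intro collapse_homotopy_identity[OF fin]) auto
  qed
  have dd: "?d (?d c) = 0" if "c \<in> chains j M" "M \<subseteq> fin_pow V" for c j M
    using that(1) unfolding in_chains_iff[OF fin that(2)] by (intro boundary_on_boundary_on fin) auto
  have h0: "?h 0 = 0" by (rule collapse_homotopy_support) simp
  let ?W = "?Z K \<inter> ?B L"
  \<comment> \<open>Surjectivity: a cycle \<open>c\<close> is replaced by
    \<open>c - ?d (?h c)\<close>, which avoids \<open>v\<close>.\<close>
  have "?Z K = {x + y |x y. x \<in> ?Z ?K \<and> y \<in> ?W}"
  proof (intro equalityI subsetI)
    fix c assume c: "c \<in> ?Z K"
    then have cK: "c \<in> chains k K" and dc: "?d c = 0" unfolding cycles_eq[OF fin KV] by auto
    have y: "?d (?h c) \<in> ?W"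
      using dh[OF cK] dd[OF h[OF cK] KV] h[OF cK] boundaries_mono[OF KL, of k]
      unfolding cycles_eq[OF fin KV] boundaries_eq[OF fin KV] by blast
    have "c - ?d (?h c) \<in> chains k ?K"
      unfolding in_chains_avoiding[OF fin KV]
      using chain_space.subspace_diff[OF subspace_chains[OF fin KV] cK dh[OF cK]] id[OF cK] dc h0
      by simp
    then have "c - ?d (?h c) \<in> ?Z ?K"
      unfolding cycles_eq[OF fin K'V] using dc dd[OF h[OF cK] KV] by (simp add: boundary_on_diff)
    moreover have "c = (c - ?d (?h c)) + ?d (?h c)" by simp
    ultimately show "c \<in> {x + y |x y. x \<in> ?Z ?K \<and> y \<in> ?W}" using y by blast
  next
    fix c assume "c \<in> {x + y |x y. x \<in> ?Z ?K \<and> y \<in> ?W}"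
    then show "c \<in> ?Z K"
      using cycles_mono[of ?K K k] chain_space.subspace_add[OF subspace_cycles[OF fin KV]] by blast
  qed
  \<comment> \<open>Injectivity: if \<open>c = ?d e\<close> avoids \<open>v\<close>, then so does
    \<open>e - ?d (?h e)\<close>, and it has the same boundary.\<close>
  moreover have "?Z ?K \<inter> ?W = ?Z ?K \<inter> ?B ?L"
  proof (intro equalityI subsetI)
    fix c assume c: "c \<in> ?Z ?K \<inter> ?W"
    then obtain e where e: "e \<in> chains (k + 1) L" "c = ?d e"
      unfolding boundaries_eq[OF fin LV] by blast
    have "\<And>xs. v \<in> set xs \<Longrightarrow> c xs = 0"
      using c unfolding cycles_eq[OF fin K'V] in_chains_avoiding[OF fin KV] by blast
    then have hc: "?h (?d e) = 0" unfolding e(2) by (rule collapse_homotopy_support)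
    have "e - ?d (?h e) \<in> chains (k + 1) ?L"
      unfolding in_chains_avoiding[OF fin LV]
      using chain_space.subspace_diff[OF subspace_chains[OF fin LV] e(1) dh[OF e(1)]] id[OF e(1)] hc
      by simp
    moreover have "c = ?d (e - ?d (?h e))"
      using e(2) dd[OF h[OF e(1)] LV] by (simp add: boundary_on_diff)
    ultimately show "c \<in> ?Z ?K \<inter> ?B ?L" using c unfolding boundaries_eq[OF fin L'V] by blast
  next
    fix c assume "c \<in> ?Z ?K \<inter> ?B ?L"
    then show "c \<in> ?Z ?K \<inter> ?W"
      using cycles_mono[of ?K K k] boundaries_mono[of ?L L k] by blast
  qed
  moreover obtain W where "finite W" "?Z K \<subseteq> chain_space.span W" "?Z ?K \<subseteq> chain_space.span W"
    using cycles_in_finite_span[OF fin] KV K'V by metis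
  moreover have "chain_space.dim {x + y |x y. x \<in> ?Z ?K \<and> y \<in> ?W} + chain_space.dim (?Z ?K \<inter> ?W)
      = chain_space.dim (?Z ?K) + chain_space.dim ?W"
    using \<open>?Z K \<subseteq> chain_space.span W\<close> \<open>?Z ?K \<subseteq> chain_space.span W\<close>
    by (intro chain_space.dim_sums_Int_finite[OF _ _ \<open>finite W\<close>] subspace_cycles[OF fin K'V]
      subspace_cycles_Int_boundaries[OF fin KV LV]) auto
  ultimately have "chain_space.dim (?Z K) + chain_space.dim (?Z ?K \<inter> ?B ?L)
      = chain_space.dim (?Z ?K) + chain_space.dim ?W" by simp
  then have "int (persistent_betti TYPE('f) k ?K ?L) = int (persistent_betti TYPE('f) k K L)"
    unfolding int_persistent_betti[OF fin KV] int_persistent_betti[OF fin K'V] by linarith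
  then show ?thesis by simp
qed

section \<open>Pulling back a complex along a surjection of the vertices\<close>

definition pullback_complex :: "'b set \<Rightarrow> ('b \<Rightarrow> 'a) \<Rightarrow> 'a set set \<Rightarrow> 'b set set" where
  "pullback_complex R p K = {\<sigma> \<in> fin_pow R. p ` \<sigma> \<in> K}"

text \<open>Chains are functions on lists, so they pull back along \<open>p\<close>. This is used to
  identify complexes along a bijection; fibres with several points are treated by deleting
  vertices.\<close>

definition relabel :: "'b set \<Rightarrow> ('b \<Rightarrow> 'a) \<Rightarrow> ('a list \<Rightarrow> 'f::field) \<Rightarrow> 'b list \<Rightarrow> 'f" where
  "relabel R p c xs = (if set xs \<subseteq> R then c (map p xs) else 0)"

lemma pullback_complex_subset: "pullback_complex R p K \<subseteq> fin_pow R"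
  by (auto simp: pullback_complex_def)

lemma pullback_complex_mono: "K \<subseteq> L \<Longrightarrow> pullback_complex R p K \<subseteq> pullback_complex R p L"
  by (auto simp: pullback_complex_def)

lemma closed_pullback_complex:
  assumes "closed_complex K"
  shows "closed_complex (pullback_complex R p K)"
  unfolding closed_complex_def
proof (intro ballI allI impI)
  fix \<sigma> \<tau> assume *: "\<sigma> \<in> pullback_complex R p K" "\<tau> \<subseteq> \<sigma> \<and> \<tau> \<noteq> {}"
  have "p ` \<tau> \<subseteq> p ` \<sigma> \<and> p ` \<tau> \<noteq> {}" using * by blast
  moreover have "p ` \<sigma> \<in> K" using * by (simp add: pullback_complex_def)
  ultimately have "p ` \<tau> \<in> K" using assms unfolding closed_complex_def by blast
  then show "\<tau> \<in> pullback_complex R p K"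
    using * finite_subset by (auto simp: pullback_complex_def fin_pow_def)
qed

lemma relabel_in_chains:
  assumes "finite R" "finite X" "K \<subseteq> fin_pow X" "c \<in> chains k K"
  shows "relabel R p c \<in> chains k (pullback_complex R p K)"
  unfolding in_chains_iff[OF assms(1) pullback_complex_subset]
proof (intro conjI allI impI)
  have c: "alternating c" "\<And>xs. c xs \<noteq> 0 \<Longrightarrow> length xs = k + 1 \<and> distinct xs \<and> set xs \<in> K"
    using assms(4) unfolding in_chains_iff[OF assms(2,3)] by blast+
  show "alternating (relabel R p c)"
    unfolding alternating_def
  proof (intro allI)
    fix xs x y ys
    show "relabel R p c (xs @ x # y # ys) = - relabel R p c (xs @ y # x # ys)"
      using alternatingD[OF c(1), of "map p xs" "p x" "p y" "map p ys"]
      by (auto simp: relabel_def)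
  qed
  fix xs assume "relabel R p c xs \<noteq> 0"
  then have xs: "set xs \<subseteq> R" "c (map p xs) \<noteq> 0" by (auto simp: relabel_def split: if_splits)
  then show "length xs = k + 1" "distinct xs" "set xs \<in> pullback_complex R p K"
    using c(2)[OF xs(2)] by (auto simp: distinct_map pullback_complex_def fin_pow_def)
qed

lemma relabel_linear:
  "Vector_Spaces.linear chain_scale chain_scale (relabel R p :: ('a list \<Rightarrow> 'f::field) \<Rightarrow> _)"
  unfolding Vector_Spaces.linear_iff
  by (intro conjI chain_space.vector_space_axioms)
    (auto simp: relabel_def chain_scale_def fun_eq_iff)

lemma relabel_0 [simp]: "relabel R p 0 = 0"
  by (auto simp: relabel_def fun_eq_iff)

lemma chains_eq_0_outside:
  assumes "finite X" "K \<subseteq> fin_pow X" "c \<in> chains k K" "\<not> set xs \<subseteq> X"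
  shows "c xs = 0"
  using assms(2-4) unfolding in_chains_iff[OF assms(1,2)] fin_pow_def by blast

lemma relabel_relabel_inverse:
  assumes "finite X" "K \<subseteq> fin_pow X" "p ` X \<subseteq> R" "\<And>x. x \<in> X \<Longrightarrow> q (p x) = x" "c \<in> chains k K"
  shows "relabel X p (relabel R q c) = c"
proof
  fix xs
  have "c xs = 0" if "\<not> set xs \<subseteq> X"
    by (rule chains_eq_0_outside[OF assms(1,2,5) that])
  moreover have "map q (map p xs) = xs" if "set xs \<subseteq> X"
    unfolding map_map using that assms(4) by (intro map_idI) auto
  ultimately show "relabel X p (relabel R q c) xs = c xs"
    using assms(3) by (auto simp: relabel_def)
qed

lemma boundary_on_relabel:
  assumes "bij_betw p R X"
  shows "boundary_on R (relabel R p c) = relabel R p (boundary_on X c)"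
proof
  fix ys
  have "(\<Sum>v\<in>R. c (p v # map p ys)) = (\<Sum>x\<in>X. c (x # map p ys))"
    by (rule sum.reindex_bij_betw[OF assms])
  then show "boundary_on R (relabel R p c) ys = relabel R p (boundary_on X c) ys"
    by (auto simp: boundary_on_def relabel_def)
qed

lemma persistent_betti_relabel:
  assumes fin: "finite R" "finite X" and p: "bij_betw p R X" and K: "K \<subseteq> fin_pow X" and L: "L \<subseteq> fin_pow X"
  shows "persistent_betti TYPE('f::field) k (pullback_complex R p K) (pullback_complex R p L)
    = persistent_betti TYPE('f) k K L"
proof -
  let ?r = "relabel R p :: (_ \<Rightarrow> 'f) \<Rightarrow> _"
  let ?Z = "\<lambda>K. cycles k K :: (_ \<Rightarrow> 'f) set" and ?Z' = "\<lambda>K. cycles k K :: (_ \<Rightarrow> 'f) set"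
  let ?B = "\<lambda>K. boundaries k K :: (_ \<Rightarrow> 'f) set" and ?B' = "\<lambda>K. boundaries k K :: (_ \<Rightarrow> 'f) set"
  define q where "q = inv_into R p"
  have q: "\<And>x. x \<in> R \<Longrightarrow> q (p x) = x" "\<And>x. x \<in> X \<Longrightarrow> p (q x) = x" "q ` X = R" "p ` R = X"
    using p by (auto simp: q_def bij_betw_def f_inv_into_f image_inv_into_cancel)
  have qp: "pullback_complex X q (pullback_complex R p M) = M" if "M \<subseteq> fin_pow X" for M
  proof -
    have *: "p ` q ` \<sigma> = \<sigma>" if "\<sigma> \<subseteq> X" for \<sigma>
      using that q(2) by (force simp: image_image)
    show ?thesis
    proof (intro equalityI subsetI)
      fix \<sigma> assume "\<sigma> \<in> pullback_complex X q (pullback_complex R p M)"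
      then show "\<sigma> \<in> M" using *[of \<sigma>] by (auto simp: pullback_complex_def fin_pow_def)
    next
      fix \<sigma> assume "\<sigma> \<in> M"
      then show "\<sigma> \<in> pullback_complex X q (pullback_complex R p M)"
        using that *[of \<sigma>] q(3) by (auto simp: pullback_complex_def fin_pow_def)
    qed
  qed
  have chains: "?r ` chains j M = chains j (pullback_complex R p M)"
    and inv: "c \<in> chains j M \<Longrightarrow> relabel X q (?r c) = c" if M: "M \<subseteq> fin_pow X" for M j c
  proof -
    show "relabel X q (?r c) = c" if "c \<in> chains j M"
      using q by (intro relabel_relabel_inverse[OF fin(2) M _ _ that]) auto
    show "?r ` chains j M = chains j (pullback_complex R p M)"
    proof (intro equalityI subsetI)
      fix c assume "c \<in> ?r ` chains j M"
      then show "c \<in> chains j (pullback_complex R p M)"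
        using relabel_in_chains[OF fin M] by blast
    next
      fix c :: "_ \<Rightarrow> 'f" assume c: "c \<in> chains j (pullback_complex R p M)"
      have "relabel X q c \<in> chains j M"
        using relabel_in_chains[OF fin(2,1) pullback_complex_subset c, of q] qp[OF M] by simp
      moreover have "?r (relabel X q c) = c"
        using q by (intro relabel_relabel_inverse[OF fin(1) pullback_complex_subset _ _ c]) auto
      ultimately show "c \<in> ?r ` chains j M" by (metis imageI)
    qed
  qed
  have inj: "inj_on ?r (chains j (fin_pow X))" for j
    using inv[OF order_refl] by (intro inj_on_inverseI)
  have dr: "boundary_on R (?r c) = ?r (boundary_on X c)" for c
    by (rule boundary_on_relabel[OF p])
  have r0: "?r (boundary_on X c) = 0 \<longleftrightarrow> boundary_on X c = 0" if "c \<in> chains j M" "M \<subseteq> fin_pow X" for c j M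
  proof
    assume z: "?r (boundary_on X c) = 0"
    show "boundary_on X c = 0"
    proof
      fix ys
      show "boundary_on X c ys = 0 ys"
      proof (cases "set ys \<subseteq> X")
        case True
        have "map p (map q ys) = ys"
          unfolding map_map using True q(2) by (intro map_idI) auto
        moreover have "set (map q ys) \<subseteq> R" using True q(3) by auto
        ultimately show ?thesis using fun_cong[OF z, of "map q ys"] by (simp add: relabel_def)
      next
        case False
        then have "c (v # ys) = 0" for v
          by (intro chains_eq_0_outside[OF fin(2) that(2,1)]) auto
        then show ?thesis by (simp add: boundary_on_def)
      qed
    qed
  qed simp
  have Z: "?Z' (pullback_complex R p M) = ?r ` ?Z M" if M: "M \<subseteq> fin_pow X" for M
    unfolding cycles_eq[OF fin(2) M] cycles_eq[OF fin(1) pullback_complex_subset] chains[OF M, symmetric]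
    using r0[OF _ M] dr by auto
  have B: "?B' (pullback_complex R p M) = ?r ` ?B M" if M: "M \<subseteq> fin_pow X" for M
    unfolding boundaries_eq[OF fin(2) M] boundaries_eq[OF fin(1) pullback_complex_subset]
      chains[OF M, symmetric] image_image dr ..
  have cyc: "?Z M \<subseteq> chains k (fin_pow X)" if M: "M \<subseteq> fin_pow X" for M
    using chains_mono[OF M, of k] unfolding cycles_def by blast
  have dimr: "chain_space.dim (?r ` S) = chain_space.dim S"
    if "S \<subseteq> ?Z K" "chain_space.subspace S" for S
    using that(1) cyc[OF K]
    by (intro vector_space_pair.dim_linear_image[OF chain_space_pair relabel_linear _ that(2)]
        inj_on_subset[OF inj[of k]]) auto
  \<comment> \<open>\<open>L\<close> is not assumed closed under faces, so \<open>c\<close> is not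
    known to be a chain of \<open>L\<close>. That it vanishes at lists outside \<open>X\<close> is
    read off from the chain \<open>e\<close> that it bounds.\<close>
  have "relabel X q (?r c) = c" if cB: "c \<in> ?B L" for c
  proof
    fix ys
    obtain e where e: "e \<in> chains (k + 1) L" "c = boundary_on X e"
      using cB unfolding boundaries_eq[OF fin(2) L] by blast
    show "relabel X q (?r c) ys = c ys"
    proof (cases "set ys \<subseteq> X")
      case True
      have "map p (map q ys) = ys"
        unfolding map_map using True q(2) by (intro map_idI) auto
      moreover have "set (map q ys) \<subseteq> R" using True q(3) by auto
      ultimately show ?thesis using True by (simp add: relabel_def)
    next
      case False
      then have "e (v # ys) = 0" for v
        using e(1) L unfolding in_chains_iff[OF fin(2) L] fin_pow_def by fastforce
      then show ?thesis using False by (simp add: e(2) boundary_on_def relabel_def)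
    qed
  qed
  moreover have "relabel X q (?r c) = c" if "c \<in> ?Z K" for c
    using inv[OF K] that unfolding cycles_def by blast
  \<comment> \<open>Injectivity on the union lets the image commute with the intersection of cycles
    and boundaries.\<close>
  ultimately have "inj_on ?r (?Z K \<union> ?B L)"
    by (intro inj_on_inverseI[where g = "relabel X q"]) auto
  then have "?r ` (?Z K \<inter> ?B L) = ?r ` ?Z K \<inter> ?r ` ?B L"
    by (rule inj_on_image_Int) auto
  then have "?Z' (pullback_complex R p K) \<inter> ?B' (pullback_complex R p L) = ?r ` (?Z K \<inter> ?B L)"
    using Z[OF K] B[OF L] by simp
  then show ?thesis
    unfolding persistent_betti_def Z[OF K]
    using dimr[OF Int_lower1 subspace_cycles_Int_boundaries[OF fin(2) K L]]
      dimr[OF order_refl subspace_cycles[OF fin(2) K]] Z[OF K] by simp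
qed

text \<open>While \<open>p\<close> identifies two points \<open>v\<close> and \<open>w\<close>, the
  point \<open>v\<close> is deleted. Adding \<open>w\<close> to a simplex through \<open>v\<close>
  does not change its image, so both pulled back complexes satisfy the insertion condition of
  \<open>persistent_betti_remove_duplicate\<close>. An injective \<open>p\<close> is a
  relabelling.\<close>

lemma persistent_betti_pullback:
  assumes "finite R" "p ` R = X" "K \<subseteq> L" "L \<subseteq> fin_pow X" "closed_complex K" "closed_complex L"
  shows "persistent_betti TYPE('f::field) k (pullback_complex R p K) (pullback_complex R p L)
    = persistent_betti TYPE('f) k K L"
  using assms(1,2)
proof (induction "card R" arbitrary: R rule: less_induct)
  case less
  show ?case
  proof (cases "inj_on p R")
    case True
    then have "bij_betw p R X" using less.prems by (simp add: bij_betw_def)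
    then show ?thesis
      using less.prems assms by (intro persistent_betti_relabel) auto
  next
    case False
    then obtain v w where vw: "v \<in> R" "w \<in> R" "v \<noteq> w" "p v = p w"
      by (auto simp: inj_on_def)
    have del: "{\<sigma> \<in> pullback_complex R p M. v \<notin> \<sigma>} = pullback_complex (R - {v}) p M" for M
      by (auto simp: pullback_complex_def fin_pow_def)
    have ins: "insert w \<sigma> \<in> pullback_complex R p M" if "\<sigma> \<in> pullback_complex R p M" "v \<in> \<sigma>" for \<sigma> M
    proof -
      have "p ` insert w \<sigma> = p ` \<sigma>" using that(2) vw(4) by (metis image_eqI image_insert insert_absorb)
      then show ?thesis using that vw(2) by (auto simp: pullback_complex_def fin_pow_def)
    qed
    have "p ` (R - {v}) = X"
      using less.prems(2) vw
      by (metis Diff_iff image_eqI image_insert insert_Diff insert_absorb singletonD)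
    moreover have "card (R - {v}) < card R" using less.prems(1) vw(1) by (rule card_Diff1_less)
    ultimately have "persistent_betti TYPE('f) k (pullback_complex (R - {v}) p K) (pullback_complex (R - {v}) p L)
        = persistent_betti TYPE('f) k K L"
      using less.hyps less.prems(1) by blast
    moreover have "persistent_betti TYPE('f) k {\<sigma> \<in> pullback_complex R p K. v \<notin> \<sigma>}
        {\<sigma> \<in> pullback_complex R p L. v \<notin> \<sigma>}
      = persistent_betti TYPE('f) k (pullback_complex R p K) (pullback_complex R p L)"
      using assms(3,5,6) vw ins
      by (intro persistent_betti_remove_duplicate[OF less.prems(1) _ pullback_complex_subset]
          pullback_complex_mono closed_pullback_complex)
    ultimately show ?thesis unfolding del by simp
  qed
qed

section \<open>Diagrams of pulled back filtrations\<close>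

lemma fin_pow_subset: "\<sigma> \<in> fin_pow X \<Longrightarrow> \<tau> \<subseteq> \<sigma> \<Longrightarrow> \<tau> \<noteq> {} \<Longrightarrow> \<tau> \<in> fin_pow X"
  unfolding fin_pow_def using finite_subset by blast

lemma is_filtrationD:
  "is_filtration X \<phi> \<Longrightarrow> \<sigma> \<in> fin_pow X \<Longrightarrow> \<tau> \<subseteq> \<sigma> \<Longrightarrow> \<tau> \<noteq> {} \<Longrightarrow> \<phi> \<tau> \<le> \<phi> \<sigma>"
  unfolding is_filtration_def using fin_pow_subset by blast

lemma closed_sublevel: "is_filtration X \<phi> \<Longrightarrow> closed_complex (sublevel X \<phi> t)"
  unfolding closed_complex_def sublevel_def
  by (clarify, rule conjI, erule (2) fin_pow_subset, erule order_trans[OF is_filtrationD]) auto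

lemma closed_strict_sublevel: "is_filtration X \<phi> \<Longrightarrow> closed_complex (strict_sublevel X \<phi> t)"
  unfolding closed_complex_def strict_sublevel_def
  by (clarify, rule conjI, erule (2) fin_pow_subset, erule le_less_trans[OF is_filtrationD]) auto

lemma closed_fin_pow: "closed_complex (fin_pow X)"
  unfolding closed_complex_def using fin_pow_subset by blast

lemma image_fin_pow:
  assumes "finite R" "p ` R = X"
  shows "(`) p ` fin_pow R = fin_pow X"
proof (intro equalityI subsetI)
  fix \<sigma> assume "\<sigma> \<in> fin_pow X"
  then have "\<sigma> = p ` (R \<inter> p -` \<sigma>)" "R \<inter> p -` \<sigma> \<in> fin_pow R"
    using assms by (auto simp: fin_pow_def)
  then show "\<sigma> \<in> (`) p ` fin_pow R" by (metis imageI)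
qed (use assms in \<open>auto simp: fin_pow_def\<close>)

lemma dgm_pullback:
  assumes "finite R" "p ` R = X" "is_filtration X \<phi>"
  shows "dgm TYPE('f::field) k R (\<lambda>\<sigma>. \<phi> (p ` \<sigma>)) = dgm TYPE('f) k X \<phi>"
proof -
  let ?\<psi> = "\<lambda>\<sigma>. \<phi> (p ` \<sigma>)"
  have im: "?\<psi> ` fin_pow R = \<phi> ` fin_pow X"
    using image_fin_pow[OF assms(1,2)] by (metis image_image)
  have *: "p ` \<sigma> \<in> fin_pow X" if "\<sigma> \<in> fin_pow R" for \<sigma>
    using that assms(2) by (auto simp: fin_pow_def)
  have pb: "sublevel R ?\<psi> t = pullback_complex R p (sublevel X \<phi> t)"
    "strict_sublevel R ?\<psi> t = pullback_complex R p (strict_sublevel X \<phi> t)"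
    "fin_pow R = pullback_complex R p (fin_pow X)" for t
    using * by (auto simp: pullback_complex_def sublevel_def strict_sublevel_def)
  note betti = persistent_betti_pullback[OF assms(1,2)]
  note closed = closed_sublevel[OF assms(3)] closed_strict_sublevel[OF assms(3)] closed_fin_pow
  have sub: "sublevel X \<phi> t \<subseteq> fin_pow X" "strict_sublevel X \<phi> t \<subseteq> fin_pow X"
    "strict_sublevel X \<phi> t \<subseteq> sublevel X \<phi> t" for t
    by (auto simp: sublevel_def strict_sublevel_def)
  \<comment> \<open>The invariance of Betti numbers concerns nested complexes. For
    \<open>b < d\<close> all four pairs in the multiplicity are nested, as the sublevel complex at
    \<open>b\<close> lies in the strict one at \<open>d\<close>; the diagram consists of such points
    only.\<close>
  have "dgm_mult TYPE('f) k R ?\<psi> b d = dgm_mult TYPE('f) k X \<phi> b d" if bd: "ereal b < d" for b d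
  proof (cases "d = \<infinity>")
    case True
    then show ?thesis
      unfolding dgm_mult_def Let_def pb
      by (simp add: betti[OF sub(1) order_refl closed(1,3)] betti[OF sub(2) order_refl closed(2,3)])
  next
    case False
    then obtain r where r: "d = ereal r" "b < r" using bd by (cases d) auto
    have 1: "sublevel X \<phi> b \<subseteq> strict_sublevel X \<phi> r"
      using r(2) by (auto simp: sublevel_def strict_sublevel_def)
    have 2: "strict_sublevel X \<phi> b \<subseteq> strict_sublevel X \<phi> r"
      "sublevel X \<phi> b \<subseteq> sublevel X \<phi> r" "strict_sublevel X \<phi> b \<subseteq> sublevel X \<phi> r"
      using 1 sub(3) by blast+
    show ?thesis
      unfolding dgm_mult_def Let_def pb r(1)
      by (simp add: betti[OF 1 sub(2) closed(1,2)] betti[OF 2(1) sub(2) closed(2,2)]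
          betti[OF 2(2) sub(1) closed(1,1)] betti[OF 2(3) sub(1) closed(2,1)])
  qed
  then show ?thesis
    unfolding dgm_def im by (intro sum.cong) auto
qed

section \<open>Stability on a fixed vertex set\<close>

lemma finite_fin_pow: "finite X \<Longrightarrow> finite (fin_pow X)"
  by (rule finite_subset[of _ "Pow X"]) (auto simp: fin_pow_def)

lemma count_dgm:
  assumes "finite X"
  shows "count (dgm F k X \<phi>) (b, d) =
    (if b \<in> \<phi> ` fin_pow X \<and> d \<in> insert \<infinity> (ereal ` \<phi> ` fin_pow X) \<and> ereal b < d
     then nat (dgm_mult F k X \<phi> b d) else 0)"
proof -
  let ?I = "{(b, d). b \<in> \<phi> ` fin_pow X \<and> d \<in> insert \<infinity> (ereal ` \<phi> ` fin_pow X) \<and> ereal b < d}"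
  have "?I \<subseteq> (\<phi> ` fin_pow X) \<times> insert \<infinity> (ereal ` \<phi> ` fin_pow X)" by blast
  then have fin: "finite ?I"
    by (rule finite_subset) (simp add: finite_fin_pow[OF assms])
  have "count (dgm F k X \<phi>) (b, d) = (\<Sum>p\<in>?I. if p = (b, d) then nat (dgm_mult F k X \<phi> b d) else 0)"
    unfolding dgm_def count_sum by (intro sum.cong refl) (auto split: prod.splits)
  also have "\<dots> = (if (b, d) \<in> ?I then nat (dgm_mult F k X \<phi> b d) else 0)"
    by (rule sum.delta[OF fin])
  finally show ?thesis by simp
qed

lemma in_dgmD:
  assumes "finite X" "p \<in># dgm F k X \<phi>"
  shows "fst p \<in> \<phi> ` fin_pow X" "snd p \<in> insert \<infinity> (ereal ` \<phi> ` fin_pow X)" "ereal (fst p) < snd p"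
  using assms(2) count_dgm[OF assms(1), of F k \<phi> "fst p" "snd p"]
  by (auto simp: not_in_iff[symmetric] split: if_splits)

text \<open>When the values are added in increasing order, the strict sublevel complex at the new
  value is the complex given by the values already present.\<close>

lemma telescope_down_closed:
  fixes g :: "'a set set \<Rightarrow> int"
  assumes "finite D" "D \<subseteq> \<theta> ` fin_pow X" "\<And>x y. x \<in> D \<Longrightarrow> y \<in> \<theta> ` fin_pow X \<Longrightarrow> y \<le> x \<Longrightarrow> y \<in> D"
  shows "(\<Sum>v\<in>D. g (sublevel X \<theta> v) - g (strict_sublevel X \<theta> v)) = g {\<sigma> \<in> fin_pow X. \<theta> \<sigma> \<in> D} - g {}"
  using assms
proof (induction D rule: finite_linorder_max_induct)
  case (insert b D)
  have "sublevel X \<theta> b = {\<sigma> \<in> fin_pow X. \<theta> \<sigma> \<in> insert b D}"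
    using insert.hyps insert.prems(2) by (auto simp: sublevel_def intro: less_imp_le)
  moreover have "strict_sublevel X \<theta> b = {\<sigma> \<in> fin_pow X. \<theta> \<sigma> \<in> D}"
  proof -
    have "y \<in> D" if "y \<in> \<theta> ` fin_pow X" "y < b" for y
      using insert.prems(2)[of b y] that by auto
    then show ?thesis using insert.hyps(2) by (auto simp: strict_sublevel_def)
  qed
  moreover have "y \<in> D" if "x \<in> D" "y \<in> \<theta> ` fin_pow X" "y \<le> x" for x y
    using insert.prems(2)[of x y] that insert.hyps(2) by force
  moreover have "b \<notin> D" using insert.hyps by auto
  ultimately show ?case using insert by simp
qed simp

text \<open>As \<open>f\<close> is monotone, its fibre over \<open>b\<close> is the difference of
  two down-closed sets of values, \<open>f v \<le> b\<close> and \<open>f v < b\<close>. They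
  describe the two sublevel complexes of \<phi> at \<open>b\<close>.\<close>

lemma telescope_fibre:
  fixes g :: "'a set set \<Rightarrow> int"
  assumes "finite X"
    and mono: "\<And>x y. x \<in> \<theta> ` fin_pow X \<Longrightarrow> y \<in> \<theta> ` fin_pow X \<Longrightarrow> x \<le> y \<Longrightarrow> f x \<le> f y"
    and \<phi>: "\<And>\<sigma>. \<sigma> \<in> fin_pow X \<Longrightarrow> \<phi> \<sigma> = f (\<theta> \<sigma>)"
  shows "(\<Sum>v | v \<in> \<theta> ` fin_pow X \<and> f v = b. g (sublevel X \<theta> v) - g (strict_sublevel X \<theta> v))
    = g (sublevel X \<phi> b) - g (strict_sublevel X \<phi> b)"
proof -
  let ?V = "\<theta> ` fin_pow X"
  let ?D = "{v \<in> ?V. f v \<le> b}" and ?E = "{v \<in> ?V. f v < b}"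
  let ?S = "\<lambda>v. g (sublevel X \<theta> v) - g (strict_sublevel X \<theta> v)"
  have fin: "finite ?V" using finite_fin_pow[OF assms(1)] by simp
  have eq: "{v. v \<in> ?V \<and> f v = b} = ?D - ?E" by auto
  have "finite ?D" "?E \<subseteq> ?D" using fin by auto
  then have "(\<Sum>v | v \<in> ?V \<and> f v = b. ?S v) = sum ?S ?D - sum ?S ?E"
    unfolding eq by (rule sum_diff)
  moreover have "sum ?S ?D = g {\<sigma> \<in> fin_pow X. \<theta> \<sigma> \<in> ?D} - g {}"
    using fin mono by (intro telescope_down_closed) (auto intro: order_trans)
  moreover have "sum ?S ?E = g {\<sigma> \<in> fin_pow X. \<theta> \<sigma> \<in> ?E} - g {}"
    using fin mono by (intro telescope_down_closed) (auto intro: le_less_trans)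
  moreover have "{\<sigma> \<in> fin_pow X. \<theta> \<sigma> \<in> ?D} = sublevel X \<phi> b"
    "{\<sigma> \<in> fin_pow X. \<theta> \<sigma> \<in> ?E} = strict_sublevel X \<phi> b"
    using \<phi> by (auto simp: sublevel_def strict_sublevel_def)
  ultimately show ?thesis by simp
qed

text \<open>Padding with diagonal points turns partial matchings into bijections, which compose.\<close>

definition near_diagrams :: "real \<Rightarrow> (real \<times> ereal) multiset \<Rightarrow> (real \<times> ereal) multiset \<Rightarrow> bool" where
  "near_diagrams e P Q \<longleftrightarrow> (\<exists>P' Q'.
     (\<forall>p \<in># P' + Q'. snd p = ereal (fst p)) \<and>
     rel_mset (\<lambda>p q. point_dist p q \<le> ereal e) (P + P') (Q + Q'))"

lemma point_dist_le_iff: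
  "point_dist p q \<le> ereal e \<longleftrightarrow>
     \<bar>fst p - fst q\<bar> \<le> e \<and> (snd p = snd q \<or> \<bar>snd p - snd q\<bar> \<le> ereal e)"
proof -
  have "0 \<le> ereal e" if "\<bar>fst p - fst q\<bar> \<le> e" using that by simp
  then show ?thesis by (auto simp: point_dist_def)
qed

lemma point_dist_triangle:
  assumes "point_dist p q \<le> ereal e" "point_dist q r \<le> ereal e'"
  shows "point_dist p r \<le> ereal (e + e')"
proof -
  have e: "0 \<le> e" "0 \<le> e'" using assms by (auto simp: point_dist_le_iff)
  then show ?thesis
    using assms unfolding point_dist_le_iff
    by (cases "snd p"; cases "snd q"; cases "snd r") auto
qed

lemma rel_mset_add:
  assumes "rel_mset R A B" "rel_mset R C D"
  shows "rel_mset R (A + C) (B + D)"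
  using assms unfolding rel_mset_def by (metis list_all2_appendI mset_append)

text \<open>The middle diagram is padded differently in the two hypotheses. Each matching is
  extended by the identity on the padding of the other, after which the middle multisets agree and
  the relations compose.\<close>

lemma near_diagrams_trans:
  assumes "near_diagrams e P Q" "near_diagrams e' Q R" "e \<ge> 0" "e' \<ge> 0"
  shows "near_diagrams (e + e') P R"
proof -
  let ?r = "\<lambda>e p q. point_dist p q \<le> ereal e"
  obtain P1 Q1 where 1: "\<forall>p \<in># P1 + Q1. snd p = ereal (fst p)" "rel_mset (?r e) (P + P1) (Q + Q1)"
    using assms(1) unfolding near_diagrams_def by blast
  obtain Q2 R2 where 2: "\<forall>p \<in># Q2 + R2. snd p = ereal (fst p)" "rel_mset (?r e') (Q + Q2) (R + R2)"
    using assms(2) unfolding near_diagrams_def by blast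
  have refl: "rel_mset (?r e) A A" if "e \<ge> 0" for e A
    using that by (intro multiset.rel_refl) (auto simp: point_dist_le_iff)
  have 3: "rel_mset (?r e) (P + P1 + Q2) (Q + Q1 + Q2)"
    by (rule rel_mset_add[OF 1(2) refl[OF assms(3)]])
  have "rel_mset (?r e') (Q + Q2 + Q1) (R + R2 + Q1)"
    by (rule rel_mset_add[OF 2(2) refl[OF assms(4)]])
  then have 4: "rel_mset (?r e') (Q + Q1 + Q2) (R + R2 + Q1)"
    by (simp only: union_ac)
  have "(rel_mset (?r e) OO rel_mset (?r e')) (P + P1 + Q2) (R + R2 + Q1)"
    by (rule relcomppI, rule 3, rule 4)
  then have "rel_mset (?r e OO ?r e') (P + P1 + Q2) (R + R2 + Q1)"
    unfolding multiset.rel_compp .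
  then have "rel_mset (?r (e + e')) (P + P1 + Q2) (R + R2 + Q1)"
    by (rule multiset.rel_mono_strong) (auto intro: point_dist_triangle)
  then show ?thesis
    unfolding near_diagrams_def using 1(1) 2(1)
    by (intro exI[of _ "P1 + Q2"] exI[of _ "R2 + Q1"]) (auto simp: add.assoc)
qed

text \<open>Both coordinates of \<open>p\<close> are within \<open>e\<close> of the same number, so
  they differ by at most \<open>2 * e\<close>; the distance to the diagonal is half of that.\<close>

lemma diag_dist_le:
  assumes "snd q = ereal (fst q)" "point_dist p q \<le> ereal e \<or> point_dist q p \<le> ereal e"
  shows "diag_dist p \<le> ereal e"
  using assms unfolding point_dist_le_iff diag_dist_def
  by (cases "snd p") auto

text \<open>From the bijection of padded diagrams keep the pairs with both ends off the diagonal. A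
  pair with exactly one such end leaves that end unmatched, and its partner on the diagonal bounds
  the cost; pairs with no such end disappear.\<close>

lemma bottleneck_dist_le_near:
  assumes "near_diagrams e P Q" "e \<ge> 0"
    and P: "\<And>p. p \<in># P \<Longrightarrow> ereal (fst p) < snd p" and Q: "\<And>q. q \<in># Q \<Longrightarrow> ereal (fst q) < snd q"
  shows "bottleneck_dist P Q \<le> ereal e"
proof -
  let ?off = "\<lambda>p :: real \<times> ereal. ereal (fst p) < snd p"
  obtain P' Q' where diag: "\<forall>p \<in># P' + Q'. snd p = ereal (fst p)"
    and rel: "rel_mset (\<lambda>p q. point_dist p q \<le> ereal e) (P + P') (Q + Q')"
    using assms(1) unfolding near_diagrams_def by blast
  obtain M where M: "set_mset M \<subseteq> {(p, q). point_dist p q \<le> ereal e}"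
    "image_mset fst M = P + P'" "image_mset snd M = Q + Q'"
    using rel unfolding multiset.in_rel by blast
  have diag': "snd p = ereal (fst p)" if "p \<in># P + P'" "\<not> ?off p" for p
    using that diag P by auto
  have diag'': "snd p = ereal (fst p)" if "p \<in># Q + Q'" "\<not> ?off p" for p
    using that diag Q by auto
  have off: "filter_mset ?off A = A" if "\<And>p. p \<in># A \<Longrightarrow> ?off p" for A
    by (intro multiset_eqI) (metis count_filter_mset not_in_iff that)
  have diag_empty: "filter_mset ?off A = {#}" if "\<And>p. p \<in># A \<Longrightarrow> snd p = ereal (fst p)" for A
    using that by (intro multiset_eqI) (auto simp: not_in_iff[symmetric])
  have filt: "filter_mset ?off (P + P') = P" "filter_mset ?off (Q + Q') = Q"
    using off[of P] off[of Q] diag_empty[of P'] diag_empty[of Q'] P Q diag by simp_all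
  let ?N = "filter_mset (\<lambda>(p, q). ?off p \<and> ?off q) M"
  let ?A = "filter_mset (\<lambda>(p, q). ?off p \<and> \<not> ?off q) M"
  let ?B = "filter_mset (\<lambda>(p, q). \<not> ?off p \<and> ?off q) M"
  have "P = image_mset fst (filter_mset (\<lambda>x. ?off (fst x)) M)"
    using filt(1) unfolding M(2)[symmetric] filter_mset_image_mset by simp
  also have "filter_mset (\<lambda>x. ?off (fst x)) M = ?N + ?A"
    by (rule multiset_eqI) (auto split: prod.splits)
  finally have P_eq: "P = image_mset fst ?N + image_mset fst ?A" by simp
  have "Q = image_mset snd (filter_mset (\<lambda>x. ?off (snd x)) M)"
    using filt(2) unfolding M(3)[symmetric] filter_mset_image_mset by simp
  also have "filter_mset (\<lambda>x. ?off (snd x)) M = ?N + ?B"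
    by (rule multiset_eqI) (auto split: prod.splits)
  finally have Q_eq: "Q = image_mset snd ?N + image_mset snd ?B" by simp
  have "?N \<in> partial_matchings P Q"
    unfolding partial_matchings_def by (simp add: P_eq Q_eq)
  then have "bottleneck_dist P Q \<le> matching_cost P Q ?N"
    unfolding bottleneck_dist_def by (rule INF_lower)
  also have "\<dots> \<le> ereal e"
  proof -
    have AB: "P - image_mset fst ?N = image_mset fst ?A" "Q - image_mset snd ?N = image_mset snd ?B"
      by (subst P_eq, simp) (subst Q_eq, simp)
    have A: "diag_dist p \<le> ereal e" if p: "p \<in># image_mset fst ?A" for p
    proof -
      obtain q where q: "(p, q) \<in># M" "\<not> ?off q" using p by auto
      then have "q \<in># Q + Q'" unfolding M(3)[symmetric] by force
      then show ?thesis using diag''[OF _ q(2)] diag_dist_le q(1) M(1) by blast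
    qed
    have B: "diag_dist q \<le> ereal e" if q: "q \<in># image_mset snd ?B" for q
    proof -
      obtain p where p: "(p, q) \<in># M" "\<not> ?off p" using q by auto
      then have "p \<in># P + P'" unfolding M(2)[symmetric] by force
      then show ?thesis using diag'[OF _ p(2)] diag_dist_le p(1) M(1) by blast
    qed
    have N: "(\<lambda>(p, q). point_dist p q) x \<le> ereal e" if "x \<in># ?N" for x
      using that M(1) by auto
    show ?thesis
      unfolding matching_cost_def AB
    proof (rule Max.boundedI)
      fix x assume "x \<in> insert 0 ((\<lambda>(p, q). point_dist p q) ` set_mset ?N
        \<union> diag_dist ` set_mset (image_mset fst ?A) \<union> diag_dist ` set_mset (image_mset snd ?B))"
      then show "x \<le> ereal e"
        by (elim insertE UnE imageE) (simp_all only: A B N, use assms(2) in simp)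
    qed auto
  qed
  finally show ?thesis .
qed

section \<open>Diagrams under monotone reparametrisation\<close>

lemma dgm_mult_nonneg:
  assumes "finite X"
  shows "0 \<le> dgm_mult TYPE('f::field) k X \<phi> b d"
proof -
  have sub: "strict_sublevel X \<phi> t \<subseteq> sublevel X \<phi> t" "sublevel X \<phi> t \<subseteq> fin_pow X" for t
    by (auto simp: sublevel_def strict_sublevel_def)
  have inf: "persistent_betti TYPE('f) k (strict_sublevel X \<phi> b) (fin_pow X)
      \<le> persistent_betti TYPE('f) k (sublevel X \<phi> b) (fin_pow X)"
    by (intro persistent_betti_mono[OF assms(1)] sub order_refl)
  have box: "persistent_betti TYPE('f) k (strict_sublevel X \<phi> b) (strict_sublevel X \<phi> r)
        + persistent_betti TYPE('f) k (sublevel X \<phi> b) (sublevel X \<phi> r)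
      \<le> persistent_betti TYPE('f) k (sublevel X \<phi> b) (strict_sublevel X \<phi> r)
        + persistent_betti TYPE('f) k (strict_sublevel X \<phi> b) (sublevel X \<phi> r)" for r
    by (intro persistent_betti_box[OF assms(1)] sub)
  show ?thesis
  proof (cases "d = \<infinity>")
    case True
    then show ?thesis using inf by (simp add: dgm_mult_def)
  next
    case False
    then show ?thesis using box[of "real_of_ereal d"] by (simp add: dgm_mult_def Let_def)
  qed
qed

text \<open>The multiplicities of a point of the coarser diagram telescope over the points that are
  mapped to it.\<close>

lemma dgm_compose_mono:
  assumes fin: "finite X"
    and mono: "\<And>x y. x \<in> \<theta> ` fin_pow X \<Longrightarrow> y \<in> \<theta> ` fin_pow X \<Longrightarrow> x \<le> y \<Longrightarrow> f x \<le> f y"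
    and \<phi>: "\<And>\<sigma>. \<sigma> \<in> fin_pow X \<Longrightarrow> \<phi> \<sigma> = f (\<theta> \<sigma>)"
  shows "dgm TYPE('f::field) k X \<phi> = filter_mset (\<lambda>p. ereal (fst p) < snd p)
    (image_mset (\<lambda>(v, w). (f v, if w = \<infinity> then \<infinity> else ereal (f (real_of_ereal w)))) (dgm TYPE('f) k X \<theta>))"
    (is "_ = filter_mset ?off (image_mset ?F ?D)")
proof (rule multiset_eqI, clarify)
  fix b d
  let ?V = "\<theta> ` fin_pow X"
  let ?m = "dgm_mult TYPE('f) k X"
  let ?\<beta> = "\<lambda>K L. int (persistent_betti TYPE('f) k K L)"
  have finV: "finite ?V" using finite_fin_pow[OF fin] by simp
  have im: "\<phi> ` fin_pow X = f ` ?V" using \<phi> by (simp add: image_image)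
  have cart: "(\<Sum>x\<in>A \<times> B. ?m \<theta> (fst x) (snd x)) = (\<Sum>v\<in>A. \<Sum>w\<in>B. ?m \<theta> v w)" for A B
    by (simp add: sum.cartesian_product case_prod_beta)
  note tel = telescope_fibre[where \<phi> = \<phi> and \<theta> = \<theta> and f = f, OF fin mono \<phi>]
  show "count (dgm TYPE('f) k X \<phi>) (b, d) = count (filter_mset ?off (image_mset ?F ?D)) (b, d)"
  proof (cases "ereal b < d")
    case False
    then show ?thesis by (simp add: count_dgm[OF fin])
  next
    case bd: True
    \<comment> \<open>All candidate preimages of the point, whether or not they occur in the diagram
      of \<theta>. As a product, this set allows telescoping in each coordinate.\<close>
    define I where "I = {v \<in> ?V. f v = b} \<times> {w \<in> insert \<infinity> (ereal ` ?V). snd (?F (b, w)) = d}"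
    have finI: "finite I" unfolding I_def using finV by auto
    \<comment> \<open>A monotone map cannot send a point on or below the diagonal to one above it.
      So for all pairs in \<open>I\<close> the diagram of \<theta> counts the full
      multiplicity.\<close>
    have lt: "ereal v < w" if "(v, w) \<in> I" for v w
    proof (cases "w = \<infinity>")
      case False
      then obtain u where u: "w = ereal u" "u \<in> ?V" "v \<in> ?V" "f v = b" "d = ereal (f u)"
        using \<open>(v, w) \<in> I\<close> by (auto simp: I_def)
      then show ?thesis using bd mono[of u v] by (metis ereal_less(1) less_ereal.simps(1) not_le)
    qed simp
    have "int (count (filter_mset ?off (image_mset ?F ?D)) (b, d))
        = int (\<Sum>x \<in> ?F -` {(b, d)} \<inter> set_mset ?D. count ?D x)"
      using bd by (simp add: count_image_mset)
    also have "(\<Sum>x \<in> ?F -` {(b, d)} \<inter> set_mset ?D. count ?D x) = (\<Sum>x\<in>I. count ?D x)"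
    proof (rule sum.mono_neutral_left[OF finI])
      show "?F -` {(b, d)} \<inter> set_mset ?D \<subseteq> I"
      proof
        fix x assume x: "x \<in> ?F -` {(b, d)} \<inter> set_mset ?D"
        obtain v w where vw: "x = (v, w)" by fastforce
        have "x \<in># ?D" using x by blast
        then have "v \<in> ?V" "w \<in> insert \<infinity> (ereal ` ?V)"
          using in_dgmD(1,2)[OF fin \<open>x \<in># ?D\<close>] by (simp_all add: vw)
        then show "x \<in> I" using x by (simp add: I_def vw)
      qed
      show "\<forall>x\<in>I - ?F -` {(b, d)} \<inter> set_mset ?D. count ?D x = 0"
      proof
        fix x assume x: "x \<in> I - ?F -` {(b, d)} \<inter> set_mset ?D"
        obtain v w where vw: "x = (v, w)" by fastforce
        have "?F x = (b, d)" using x by (simp add: I_def vw)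
        then have "x \<notin># ?D" using x by blast
        then show "count ?D x = 0" by (simp add: not_in_iff)
      qed
    qed
    also have "int \<dots> = (\<Sum>x\<in>I. ?m \<theta> (fst x) (snd x))"
      unfolding of_nat_sum
    proof (rule sum.cong)
      fix x assume x: "x \<in> I"
      obtain v w where vw: "x = (v, w)" by fastforce
      then have "ereal v < w" "v \<in> ?V" "w \<in> insert \<infinity> (ereal ` ?V)"
        using x lt by (auto simp: I_def)
      then show "int (count ?D x) = ?m \<theta> (fst x) (snd x)"
        unfolding vw count_dgm[OF fin] using dgm_mult_nonneg[OF fin] by simp
    qed simp
    also have "\<dots> = int (count (dgm TYPE('f) k X \<phi>) (b, d))"
    proof (cases "b \<in> f ` ?V \<and> d \<in> insert \<infinity> (ereal ` f ` ?V)")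
      case False
      then have "I = {}" by (auto simp: I_def)
      moreover have "count (dgm TYPE('f) k X \<phi>) (b, d) = 0"
        unfolding count_dgm[OF fin] im using False by (intro if_not_P) blast
      ultimately show ?thesis by simp
    next
      case True
      have "(\<Sum>x\<in>I. ?m \<theta> (fst x) (snd x)) = ?m \<phi> b d"
      proof (cases "d = \<infinity>")
        case True
        then have I: "I = {v. v \<in> ?V \<and> f v = b} \<times> {\<infinity>}" by (auto simp: I_def)
        have "(\<Sum>x\<in>I. ?m \<theta> (fst x) (snd x)) = (\<Sum>v | v \<in> ?V \<and> f v = b. ?m \<theta> v \<infinity>)"
          unfolding I cart by simp
        also have "\<dots> = ?m \<phi> b d"
          unfolding True dgm_mult_def Let_def
          using tel[of "\<lambda>K. ?\<beta> K (fin_pow X)" b] by simp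
        finally show ?thesis .
      next
        case False
        then obtain r where r: "d = ereal r" using bd by (cases d) auto
        let ?G = "\<lambda>L. ?\<beta> (sublevel X \<phi> b) L - ?\<beta> (strict_sublevel X \<phi> b) L"
        have I: "I = {v. v \<in> ?V \<and> f v = b} \<times> ereal ` {w. w \<in> ?V \<and> f w = r}"
          by (auto simp: I_def r split: if_splits)
        have "(\<Sum>x\<in>I. ?m \<theta> (fst x) (snd x))
            = (\<Sum>v | v \<in> ?V \<and> f v = b. \<Sum>w | w \<in> ?V \<and> f w = r. ?m \<theta> v (ereal w))"
          unfolding I cart by (simp add: sum.reindex inj_on_def)
        also have "\<dots> = (\<Sum>w | w \<in> ?V \<and> f w = r. \<Sum>v | v \<in> ?V \<and> f v = b. ?m \<theta> v (ereal w))"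
          by (rule sum.swap)
        \<comment> \<open>The births telescope first, for each of the two complexes at the death
          value \<open>w\<close>, and leave the increment \<open>?G\<close> at birth
          \<open>b\<close>. The deaths telescope afterwards; the strict complex has the positive
          sign there, hence the minus.\<close>
        also have "\<dots> = (\<Sum>w | w \<in> ?V \<and> f w = r.
            - (?G (sublevel X \<theta> w) - ?G (strict_sublevel X \<theta> w)))"
        proof (rule sum.cong[OF refl])
          fix w
          have "(\<Sum>v | v \<in> ?V \<and> f v = b. ?m \<theta> v (ereal w))
            = (\<Sum>v | v \<in> ?V \<and> f v = b. ?\<beta> (sublevel X \<theta> v) (strict_sublevel X \<theta> w)
                - ?\<beta> (strict_sublevel X \<theta> v) (strict_sublevel X \<theta> w))
            - (\<Sum>v | v \<in> ?V \<and> f v = b. ?\<beta> (sublevel X \<theta> v) (sublevel X \<theta> w)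
                - ?\<beta> (strict_sublevel X \<theta> v) (sublevel X \<theta> w))"
            unfolding sum_subtractf[symmetric] by (simp add: dgm_mult_def Let_def algebra_simps)
          also have "\<dots> = - (?G (sublevel X \<theta> w) - ?G (strict_sublevel X \<theta> w))"
            using tel[of "\<lambda>K. ?\<beta> K (strict_sublevel X \<theta> w)" b]
              tel[of "\<lambda>K. ?\<beta> K (sublevel X \<theta> w)" b] by simp
          finally show "(\<Sum>v | v \<in> ?V \<and> f v = b. ?m \<theta> v (ereal w))
            = - (?G (sublevel X \<theta> w) - ?G (strict_sublevel X \<theta> w))" .
        qed
        also have "\<dots> = - (?G (sublevel X \<phi> r) - ?G (strict_sublevel X \<phi> r))"
          unfolding sum_negf using tel[of ?G r] by simp
        also have "\<dots> = ?m \<phi> b d"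
          by (simp add: r dgm_mult_def Let_def)
        finally show ?thesis .
      qed
      moreover have "count (dgm TYPE('f) k X \<phi>) (b, d) = nat (?m \<phi> b d)"
        unfolding count_dgm[OF fin] im using True bd by (intro if_P) blast
      ultimately show ?thesis using dgm_mult_nonneg[OF fin] by simp
    qed
    finally show ?thesis by simp
  qed
qed

text \<open>If no pair of simplices is ordered strictly oppositely by \<open>a\<close> and
  \<open>b\<close>, then both are monotone functions of \<open>a + b\<close>. Each point of the
  diagram of \<open>a + b\<close> has an image for \<open>a\<close> and one for \<open>b\<close>, at
  distance at most \<open>e\<close>; matching these two images gives the bijection, and images on
  the diagonal are the padding.\<close>

lemma near_diagrams_compatible:
  assumes fin: "finite X"
    and comp: "\<And>\<sigma> \<tau>. \<sigma> \<in> fin_pow X \<Longrightarrow> \<tau> \<in> fin_pow X \<Longrightarrow> a \<sigma> < a \<tau> \<Longrightarrow> b \<sigma> \<le> b \<tau>"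
    and close: "\<And>\<sigma>. \<sigma> \<in> fin_pow X \<Longrightarrow> \<bar>a \<sigma> - b \<sigma>\<bar> \<le> e" and "e \<ge> 0"
  shows "near_diagrams e (dgm TYPE('f::field) k X a) (dgm TYPE('f) k X b)"
proof -
  define \<theta> where "\<theta> \<sigma> = a \<sigma> + b \<sigma>" for \<sigma>
  \<comment> \<open>A representative simplex for each value of \<theta>. By \<open>val\<close> the
    choice does not affect the values of \<open>a\<close> and \<open>b\<close>.\<close>
  define s where "s = inv_into (fin_pow X) \<theta>"
  let ?V = "\<theta> ` fin_pow X"
  let ?P = "dgm TYPE('f) k X \<theta>"
  let ?off = "\<lambda>p :: real \<times> ereal. ereal (fst p) < snd p"
  define F :: "(real \<Rightarrow> real) \<Rightarrow> real \<times> ereal \<Rightarrow> real \<times> ereal" where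
    "F = (\<lambda>f (v, w). (f v, if w = \<infinity> then \<infinity> else ereal (f (real_of_ereal w))))"
  have ab: "a \<sigma> \<le> a \<tau>" "b \<sigma> \<le> b \<tau>"
    if "\<sigma> \<in> fin_pow X" "\<tau> \<in> fin_pow X" "\<theta> \<sigma> \<le> \<theta> \<tau>" for \<sigma> \<tau>
    using comp[of \<sigma> \<tau>] comp[of \<tau> \<sigma>] that unfolding \<theta>_def by linarith+
  have s: "s v \<in> fin_pow X" "\<theta> (s v) = v" if "v \<in> ?V" for v
    using that unfolding s_def by (auto intro: inv_into_into f_inv_into_f)
  have mono: "a (s v) \<le> a (s w)" "b (s v) \<le> b (s w)" if "v \<in> ?V" "w \<in> ?V" "v \<le> w" for v w
    using ab[of "s v" "s w"] s that by auto
  have val: "a \<sigma> = a (s (\<theta> \<sigma>))" "b \<sigma> = b (s (\<theta> \<sigma>))" if "\<sigma> \<in> fin_pow X" for \<sigma>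
    using ab[of \<sigma> "s (\<theta> \<sigma>)"] ab[of "s (\<theta> \<sigma>)" \<sigma>] s[of "\<theta> \<sigma>"] that by (auto intro: antisym)
  have D: "dgm TYPE('f) k X a = filter_mset ?off (image_mset (F (\<lambda>v. a (s v))) ?P)"
    "dgm TYPE('f) k X b = filter_mset ?off (image_mset (F (\<lambda>v. b (s v))) ?P)"
    unfolding F_def
    by (rule dgm_compose_mono[where f = "\<lambda>v. a (s v)", OF fin mono(1) val(1)], assumption+,
        rule dgm_compose_mono[where f = "\<lambda>v. b (s v)", OF fin mono(2) val(2)], assumption+)
  let ?rest = "filter_mset (\<lambda>p. \<not> ?off p)"
  \<comment> \<open>A monotone map keeps birth at most death, so a point that fails to be off the
    diagonal lies exactly on it.\<close>
  have diag: "snd q = ereal (fst q)" if q: "q \<in># ?rest (image_mset (F f) ?P)"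
    and f: "\<And>v w. v \<in> ?V \<Longrightarrow> w \<in> ?V \<Longrightarrow> v \<le> w \<Longrightarrow> f v \<le> f w" for q f
  proof -
    obtain p where p: "p \<in># ?P" "q = F f p" "\<not> ?off q" using q by auto
    obtain v w where vw: "p = (v, w)" by fastforce
    then have v: "v \<in> ?V" "w \<in> insert \<infinity> (ereal ` ?V)" "ereal v < w"
      using in_dgmD[OF fin p(1)] by auto
    moreover have "w \<noteq> \<infinity>" using p(2,3) vw by (auto simp: F_def)
    ultimately obtain u where "w = ereal u" "u \<in> ?V" "v < u" by auto
    then show ?thesis using p(2,3) f[OF v(1), of u] vw by (auto simp: F_def)
  qed
  have rel: "rel_mset (\<lambda>p q. point_dist p q \<le> ereal e)
      (image_mset (F (\<lambda>v. a (s v))) ?P) (image_mset (F (\<lambda>v. b (s v))) ?P)"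
    unfolding multiset.rel_map
  proof (rule multiset.rel_refl_strong)
    fix p assume "p \<in># ?P"
    note p = in_dgmD(1,2)[OF fin \<open>p \<in># ?P\<close>]
    obtain v w where vw: "p = (v, w)" by fastforce
    have v: "\<bar>a (s v) - b (s v)\<bar> \<le> e" if "v \<in> ?V" for v using close s(1) that by blast
    show "point_dist (F (\<lambda>v. a (s v)) p) (F (\<lambda>v. b (s v)) p) \<le> ereal e"
    proof (cases "w = \<infinity>")
      case True
      then show ?thesis using p(1) v unfolding point_dist_le_iff by (simp add: F_def vw)
    next
      case False
      then obtain u where "w = ereal u" "u \<in> ?V" using p(2) by (auto simp: vw)
      then show ?thesis using p(1) v unfolding point_dist_le_iff by (simp add: F_def vw)
    qed
  qed
  have split: "filter_mset ?off A + ?rest A = A" for A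
    by (rule multiset_partition[symmetric])
  have "rel_mset (\<lambda>p q. point_dist p q \<le> ereal e)
      (dgm TYPE('f) k X a + ?rest (image_mset (F (\<lambda>v. a (s v))) ?P))
      (dgm TYPE('f) k X b + ?rest (image_mset (F (\<lambda>v. b (s v))) ?P))"
    unfolding D split by (rule rel)
  moreover have "snd q = ereal (fst q)"
    if "q \<in># ?rest (image_mset (F (\<lambda>v. a (s v))) ?P) + ?rest (image_mset (F (\<lambda>v. b (s v))) ?P)" for q
    using that unfolding union_iff
    by (elim disjE) (rule diag[where f = "\<lambda>v. a (s v)", OF _ mono(1)], assumption+,
        rule diag[where f = "\<lambda>v. b (s v)", OF _ mono(2)], assumption+)
  ultimately show ?thesis
    unfolding near_diagrams_def by blast
qed

text \<open>Splitting at a point of \<open>C\<close> leaves fewer points of \<open>C\<close> inside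
  each half, because the split point becomes an endpoint and only interior points count.\<close>

lemma interval_chain:
  fixes s t :: real
  assumes "finite C" "s \<le> t"
    and base: "\<And>s t. s \<le> t \<Longrightarrow> C \<inter> {s<..<t} = {} \<Longrightarrow> Q s t"
    and trans: "\<And>s u t. s \<le> u \<Longrightarrow> u \<le> t \<Longrightarrow> Q s u \<Longrightarrow> Q u t \<Longrightarrow> Q s t"
  shows "Q s t"
  using assms(2)
proof (induction "card (C \<inter> {s<..<t})" arbitrary: s t rule: less_induct)
  case less
  show ?case
  proof (cases "C \<inter> {s<..<t} = {}")
    case True
    then show ?thesis using base less.prems by blast
  next
    case False
    then obtain u where u: "u \<in> C" "s < u" "u < t" by auto
    have "C \<inter> {s<..<u} \<subset> C \<inter> {s<..<t}" "C \<inter> {u<..<t} \<subset> C \<inter> {s<..<t}"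
      using u by auto
    then have "card (C \<inter> {s<..<u}) < card (C \<inter> {s<..<t})" "card (C \<inter> {u<..<t}) < card (C \<inter> {s<..<t})"
      using assms(1) by (meson finite_Int psubset_card_mono)+
    then have "Q s u" "Q u t" using less.hyps u by auto
    then show ?thesis using trans u by (meson less_imp_le)
  qed
qed

lemma near_diagrams_stability:
  assumes fin: "finite X" and close: "\<And>\<sigma>. \<sigma> \<in> fin_pow X \<Longrightarrow> \<bar>\<phi> \<sigma> - \<psi> \<sigma>\<bar> \<le> e" and "e \<ge> 0"
  shows "near_diagrams e (dgm TYPE('f::field) k X \<phi>) (dgm TYPE('f) k X \<psi>)"
proof -
  define h where "h t \<sigma> = \<phi> \<sigma> + t * (\<psi> \<sigma> - \<phi> \<sigma>)" for t \<sigma>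
  \<comment> \<open>The times at which the affine functions \<open>h t \<sigma>\<close> and
    \<open>h t \<tau>\<close> of \<open>t\<close> cross. For parallel ones the division by 0 only
    adds the harmless point 0.\<close>
  define C where "C = (\<lambda>(\<sigma>, \<tau>). (\<phi> \<sigma> - \<phi> \<tau>) / ((\<phi> \<sigma> - \<phi> \<tau>) - (\<psi> \<sigma> - \<psi> \<tau>))) ` (fin_pow X \<times> fin_pow X)"
  have "near_diagrams ((1 - 0) * e) (dgm TYPE('f) k X (h 0)) (dgm TYPE('f) k X (h 1))"
  proof (rule interval_chain[of C 0 1 "\<lambda>s t. near_diagrams ((t - s) * e) (dgm TYPE('f) k X (h s)) (dgm TYPE('f) k X (h t))"])
    show "finite C" unfolding C_def using finite_fin_pow[OF fin] by simp
  next
    fix s u t :: real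
    assume "s \<le> u" "u \<le> t"
      "near_diagrams ((u - s) * e) (dgm TYPE('f) k X (h s)) (dgm TYPE('f) k X (h u))"
      "near_diagrams ((t - u) * e) (dgm TYPE('f) k X (h u)) (dgm TYPE('f) k X (h t))"
    then have "near_diagrams ((u - s) * e + (t - u) * e) (dgm TYPE('f) k X (h s)) (dgm TYPE('f) k X (h t))"
      using assms(3) by (intro near_diagrams_trans) auto
    then show "near_diagrams ((t - s) * e) (dgm TYPE('f) k X (h s)) (dgm TYPE('f) k X (h t))"
      by (simp add: algebra_simps)
  next
    fix s t :: real
    assume st: "s \<le> t" "C \<inter> {s<..<t} = {}"
    show "near_diagrams ((t - s) * e) (dgm TYPE('f) k X (h s)) (dgm TYPE('f) k X (h t))"
    proof (rule near_diagrams_compatible[OF fin])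
      fix \<sigma> assume "\<sigma> \<in> fin_pow X"
      have "\<bar>h s \<sigma> - h t \<sigma>\<bar> = (t - s) * \<bar>\<phi> \<sigma> - \<psi> \<sigma>\<bar>"
      proof -
        have "h s \<sigma> - h t \<sigma> = (t - s) * (\<phi> \<sigma> - \<psi> \<sigma>)" by (simp add: h_def algebra_simps)
        then show ?thesis using st(1) by (simp add: abs_mult)
      qed
      also have "\<dots> \<le> (t - s) * e" using st(1) close[OF \<open>\<sigma> \<in> fin_pow X\<close>] by (intro mult_left_mono) auto
      finally show "\<bar>h s \<sigma> - h t \<sigma>\<bar> \<le> (t - s) * e" .
    next
      fix \<sigma> \<tau> assume \<sigma>\<tau>: "\<sigma> \<in> fin_pow X" "\<tau> \<in> fin_pow X" "h s \<sigma> < h s \<tau>"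
      show "h t \<sigma> \<le> h t \<tau>"
      proof (rule ccontr)
        assume "\<not> h t \<sigma> \<le> h t \<tau>"
        define A where "A = \<phi> \<sigma> - \<phi> \<tau>"
        define B where "B = A - (\<psi> \<sigma> - \<psi> \<tau>)"
        have "h u \<sigma> - h u \<tau> = A - u * B" for u
          by (simp add: h_def A_def B_def algebra_simps)
        then have *: "A < s * B" "t * B < A"
          using \<open>\<not> h t \<sigma> \<le> h t \<tau>\<close> \<sigma>\<tau>(3) by (smt (verit))+
        \<comment> \<open>The difference \<open>A - u * B\<close> is negative at
          \<open>u = s\<close> and positive at \<open>u = t\<close>, so it increases and its zero
          \<open>A / B\<close> lies strictly between: a crossing time that the hypothesis
          excludes.\<close>
        have "B < 0"
        proof (rule ccontr)
          assume "\<not> B < 0"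
          then have "s * B \<le> t * B" using st(1) by (intro mult_right_mono) auto
          then show False using * by linarith
        qed
        then have "A / B \<in> {s<..<t}" using * by (simp add: field_simps)
        moreover have "A / B \<in> C" unfolding C_def A_def B_def using \<sigma>\<tau> by force
        ultimately show False using st(2) by blast
      qed
    qed (use st(1) assms(3) in simp)
  qed simp
  moreover have "h 0 = \<phi>" "h 1 = \<psi>" by (auto simp: h_def fun_eq_iff)
  ultimately show ?thesis by simp
qed

section \<open>Correspondences and basepoint curvature sets\<close>

lemma fin_metric_spacesD:
  assumes "X \<in> fin_metric_spaces"
  shows "finite (mspace X)" "mspace X \<noteq> {}"
  using assms by (auto simp: fin_metric_spaces_def)

lemma finite_correspondences:
  assumes "X \<in> fin_metric_spaces" "Y \<in> fin_metric_spaces"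
  shows "finite (correspondences X Y)" "correspondences X Y \<noteq> {}"
proof -
  have "correspondences X Y \<subseteq> Pow (mspace X \<times> mspace Y)" by (auto simp: correspondences_def)
  then show "finite (correspondences X Y)"
    by (rule finite_subset) (simp add: fin_metric_spacesD assms)
  have "mspace X \<times> mspace Y \<in> correspondences X Y"
    using fin_metric_spacesD[OF assms(1)] fin_metric_spacesD[OF assms(2)]
    by (simp add: correspondences_def)
  then show "correspondences X Y \<noteq> {}" by blast
qed

lemma correspondenceD:
  assumes "X \<in> fin_metric_spaces" "Y \<in> fin_metric_spaces" "R \<in> correspondences X Y"
  shows "finite R" "R \<noteq> {}" "fst ` R = mspace X" "snd ` R = mspace Y"
proof -
  have R: "R \<subseteq> mspace X \<times> mspace Y" "fst ` R = mspace X" "snd ` R = mspace Y"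
    using assms(3) by (simp_all add: correspondences_def)
  then show "fst ` R = mspace X" "snd ` R = mspace Y" by simp_all
  show "finite R"
    using R(1) by (rule finite_subset) (simp add: fin_metric_spacesD assms)
  show "R \<noteq> {}" using R(2) fin_metric_spacesD(2)[OF assms(1)] by auto
qed

lemma distortion_ge:
  assumes "finite R" "p \<in> R" "q \<in> R"
  shows "\<bar>mdist X (fst p) (fst q) - mdist Y (snd p) (snd q)\<bar> \<le> distortion X Y R"
proof -
  let ?g = "\<lambda>((x, y), (x', y')). \<bar>mdist X x x' - mdist Y y y'\<bar>"
  have "?g (p, q) \<le> Max (?g ` (R \<times> R))"
    using assms by (intro Max_ge finite_imageI finite_cartesian_product imageI SigmaI)
  then show ?thesis by (simp add: distortion_def case_prod_beta)
qed

lemma distortion_nonneg: "finite R \<Longrightarrow> p \<in> R \<Longrightarrow> 0 \<le> distortion X Y R"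
  by (rule order_trans[OF abs_ge_zero distortion_ge])

lemma infnorm_matrix_le:
  fixes M :: "real ^ 'm ^ 'n"
  assumes "\<And>i j. \<bar>M $ i $ j\<bar> \<le> e"
  shows "infnorm M \<le> e"
  unfolding infnorm_Max
proof (rule Max.boundedI)
  fix x assume "x \<in> (\<lambda>i. \<bar>M \<bullet> i\<bar>) ` Basis"
  then obtain i j where "x = \<bar>M \<bullet> axis i (axis j 1)\<bar>" by (auto simp: Basis_vec_def)
  then show "x \<le> e" using assms by (simp add: inner_axis)
qed auto

lemma hausdorff_dist_le:
  assumes "A \<in> fin_pow UNIV" "B \<in> fin_pow UNIV"
    and "\<And>a. a \<in> A \<Longrightarrow> \<exists>b\<in>B. infnorm (a - b) \<le> e"
    and "\<And>b. b \<in> B \<Longrightarrow> \<exists>a\<in>A. infnorm (a - b) \<le> e"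
  shows "hausdorff_dist A B \<le> e"
proof -
  have fin: "finite A" "A \<noteq> {}" "finite B" "B \<noteq> {}"
    using assms(1,2) by (auto simp: fin_pow_def)
  have "(MIN b \<in> B. infnorm (a - b)) \<le> e" if "a \<in> A" for a
    using assms(3)[OF that] fin by (subst Min_le_iff) auto
  moreover have "(MIN a \<in> A. infnorm (a - b)) \<le> e" if "b \<in> B" for b
    using assms(4)[OF that] fin by (subst Min_le_iff) auto
  ultimately have "\<forall>x \<in> (\<lambda>a. MIN b \<in> B. infnorm (a - b)) ` A. x \<le> e"
    "\<forall>x \<in> (\<lambda>b. MIN a \<in> A. infnorm (a - b)) ` B. x \<le> e" by blast+
  then show ?thesis
    unfolding hausdorff_dist_def using fin by (intro max.boundedI Max.boundedI) auto
qed

text \<open>A tuple of points in one projection of \<sigma> lifts to a tuple of pairs in \<sigma>,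
  and the other components give the partner matrix. Since all pairs lie in \<open>R\<close>, each
  entry changes by at most the distortion.\<close>

lemma hausdorff_dist_curvature_set_le:
  assumes R: "finite R" and \<sigma>: "\<sigma> \<in> fin_pow R" and x0y0: "(x0, y0) \<in> R"
  shows "hausdorff_dist (curvature_set X x0 (fst ` \<sigma>) :: ('n::finite) dist_matrix set)
    (curvature_set Y y0 (snd ` \<sigma>)) \<le> distortion X Y R"
proof -
  let ?M = "\<lambda>(Z :: _ metric) z0 z. (\<chi> i j. mdist Z (case_option z0 z i) (case_option z0 z j)) :: 'n dist_matrix"
  have img: "fst ` \<sigma> \<in> fin_pow UNIV" "snd ` \<sigma> \<in> fin_pow UNIV"
    using \<sigma> by (auto simp: fin_pow_def)
  have *: "infnorm (?M X x0 (\<lambda>i. fst (p i)) - ?M Y y0 (\<lambda>i. snd (p i))) \<le> distortion X Y R"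
    if "range p \<subseteq> \<sigma>" for p :: "'n \<Rightarrow> _"
  proof (rule infnorm_matrix_le)
    fix i j :: "'n option"
    \<comment> \<open>The basepoints form the pair with index \<open>None\<close>, so entries that
      involve them are covered as well.\<close>
    let ?P = "case_option (x0, y0) p"
    have "?P i \<in> R" for i
      using that \<sigma> x0y0 by (auto simp: fin_pow_def split: option.split)
    then have "\<bar>mdist X (fst (?P i)) (fst (?P j)) - mdist Y (snd (?P i)) (snd (?P j))\<bar> \<le> distortion X Y R"
      by (intro distortion_ge R)
    moreover have "fst (?P i) = case_option x0 (\<lambda>i. fst (p i)) i"
      "snd (?P i) = case_option y0 (\<lambda>i. snd (p i)) i" for i
      by (simp_all split: option.split)
    ultimately show "\<bar>(?M X x0 (\<lambda>i. fst (p i)) - ?M Y y0 (\<lambda>i. snd (p i))) $ i $ j\<bar> \<le> distortion X Y R"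
      by simp
  qed
  show ?thesis
  proof (rule hausdorff_dist_le)
    show "(curvature_set X x0 (fst ` \<sigma>) :: 'n dist_matrix set) \<in> fin_pow UNIV"
      "(curvature_set Y y0 (snd ` \<sigma>) :: 'n dist_matrix set) \<in> fin_pow UNIV"
      by (rule curvature_set_in_fin_pow[OF img(1)], rule curvature_set_in_fin_pow[OF img(2)])
  next
    fix a :: "'n dist_matrix" assume "a \<in> curvature_set X x0 (fst ` \<sigma>)"
    then obtain x where x: "a = ?M X x0 x" "range x \<subseteq> fst ` \<sigma>" unfolding curvature_set_def by blast
    have "\<exists>p. p \<in> \<sigma> \<and> x i = fst p" for i using x(2) by blast
    then obtain p where p: "\<And>i. p i \<in> \<sigma>" "\<And>i. x i = fst (p i)" by metis
    have xp: "x = (\<lambda>i. fst (p i))" using p(2) by blast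
    have "?M Y y0 (\<lambda>i. snd (p i)) \<in> curvature_set Y y0 (snd ` \<sigma>)"
      unfolding curvature_set_def using p(1) by blast
    moreover have "infnorm (a - ?M Y y0 (\<lambda>i. snd (p i))) \<le> distortion X Y R"
      unfolding x(1) xp by (rule *) (use p(1) in blast)
    ultimately show "\<exists>b\<in>curvature_set Y y0 (snd ` \<sigma>). infnorm (a - b) \<le> distortion X Y R" by blast
  next
    fix b :: "'n dist_matrix" assume "b \<in> curvature_set Y y0 (snd ` \<sigma>)"
    then obtain y where y: "b = ?M Y y0 y" "range y \<subseteq> snd ` \<sigma>" unfolding curvature_set_def by blast
    have "\<exists>p. p \<in> \<sigma> \<and> y i = snd p" for i using y(2) by blast
    then obtain p where p: "\<And>i. p i \<in> \<sigma>" "\<And>i. y i = snd (p i)" by metis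
    have yp: "y = (\<lambda>i. snd (p i))" using p(2) by blast
    have "?M X x0 (\<lambda>i. fst (p i)) \<in> curvature_set X x0 (fst ` \<sigma>)"
      unfolding curvature_set_def using p(1) by blast
    moreover have "infnorm (?M X x0 (\<lambda>i. fst (p i)) - b) \<le> distortion X Y R"
      unfolding y(1) yp by (rule *) (use p(1) in blast)
    ultimately show "\<exists>a\<in>curvature_set X x0 (fst ` \<sigma>). infnorm (a - b) \<le> distortion X Y R" by blast
  qed
qed

section \<open>The cost along a correspondence\<close>

lemma stable_descriptorD:
  assumes "stable_descriptor K \<rho>" "X \<in> fin_metric_spaces" "Y \<in> fin_metric_spaces"
    "R \<in> correspondences X Y" "(x0, y0) \<in> R"
  shows "infnorm (\<rho> X x0 - \<rho> Y y0) \<le> K * distortion X Y R"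
proof -
  let ?g = "\<lambda>(x0, y0). infnorm (\<rho> X x0 - \<rho> Y y0)"
  have "?g (x0, y0) \<le> Max (?g ` R)"
    using correspondenceD(1)[OF assms(2-4)] assms(5) by (intro Max_ge finite_imageI imageI)
  also have "\<dots> \<le> K * distortion X Y R"
    using assms unfolding stable_descriptor_def by blast
  finally show ?thesis by simp
qed

text \<open>The constant combines two bounds: curvature sets differ by at most the distortion and
  descriptors by at most \<open>K\<close> times it. Stability of \<nu> multiplies the larger one by
  \<open>L\<close>.\<close>

lemma cost_local_functor_le:
  fixes \<nu> :: "('n::finite) dist_matrix set \<Rightarrow> real ^ 'l \<Rightarrow> real"
  assumes "L \<ge> 0" "adjusted_valuation \<nu>" "stable_valuation L \<nu>" "stable_descriptor K \<rho>"
    and X: "X \<in> fin_metric_spaces" and Y: "Y \<in> fin_metric_spaces"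
    and R: "R \<in> correspondences X Y" and x0y0: "(x0, y0) \<in> R"
  shows "cost TYPE('f::field) (local_functor \<nu> \<rho>) k X Y x0 y0 \<le> ereal (L * max 1 K * distortion X Y R)"
proof -
  let ?\<Psi> = "local_functor \<nu> \<rho>"
  let ?e = "L * max 1 K * distortion X Y R"
  let ?\<phi> = "\<lambda>\<sigma>. ?\<Psi> X x0 (fst ` \<sigma>)" and ?\<psi> = "\<lambda>\<sigma>. ?\<Psi> Y y0 (snd ` \<sigma>)"
  note R' = correspondenceD[OF X Y R]
  have dis: "0 \<le> distortion X Y R" by (rule distortion_nonneg[OF R'(1) x0y0])
  have e: "0 \<le> ?e" using assms(1) dis by simp
  have "x0 \<in> mspace X" "y0 \<in> mspace Y" using R'(3,4) x0y0 by force+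
  then have filt: "is_filtration (mspace X) (?\<Psi> X x0)" "is_filtration (mspace Y) (?\<Psi> Y y0)"
    using basepoint_filtration_functor_local[OF assms(2), of \<rho>] X Y
    unfolding basepoint_filtration_functor_def by simp_all
  have close: "\<bar>?\<phi> \<sigma> - ?\<psi> \<sigma>\<bar> \<le> ?e" if \<sigma>: "\<sigma> \<in> fin_pow R" for \<sigma>
  proof -
    let ?A = "curvature_set X x0 (fst ` \<sigma>) :: 'n dist_matrix set"
    let ?B = "curvature_set Y y0 (snd ` \<sigma>) :: 'n dist_matrix set"
    have "fst ` \<sigma> \<in> fin_pow UNIV" "snd ` \<sigma> \<in> fin_pow UNIV"
      using \<sigma> by (auto simp: fin_pow_def)
    then have "?A \<in> fin_pow UNIV" "?B \<in> fin_pow UNIV"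
      by (blast intro: curvature_set_in_fin_pow)+
    then have "\<bar>\<nu> ?A (\<rho> X x0) - \<nu> ?B (\<rho> Y y0)\<bar>
        \<le> L * max (hausdorff_dist ?A ?B) (infnorm (\<rho> X x0 - \<rho> Y y0))"
      using assms(3) unfolding stable_valuation_def by blast
    also have "max (hausdorff_dist ?A ?B) (infnorm (\<rho> X x0 - \<rho> Y y0)) \<le> max 1 K * distortion X Y R"
    proof (rule max.boundedI)
      have "1 * distortion X Y R \<le> max 1 K * distortion X Y R"
        using dis by (intro mult_right_mono) auto
      then show "hausdorff_dist ?A ?B \<le> max 1 K * distortion X Y R"
        using hausdorff_dist_curvature_set_le[OF R'(1) \<sigma> x0y0, of X Y, where 'n = 'n] by linarith
      have "K * distortion X Y R \<le> max 1 K * distortion X Y R"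
        using dis by (intro mult_right_mono) auto
      then show "infnorm (\<rho> X x0 - \<rho> Y y0) \<le> max 1 K * distortion X Y R"
        using stable_descriptorD[OF assms(4) X Y R x0y0] by linarith
    qed
    finally show ?thesis
      using assms(1) by (simp add: local_functor_def mult.assoc mult_left_mono)
  qed
  have "near_diagrams ?e (dgm TYPE('f) k R ?\<phi>) (dgm TYPE('f) k R ?\<psi>)"
    by (rule near_diagrams_stability[OF R'(1) close e])
  then have "near_diagrams ?e (dgm TYPE('f) k (mspace X) (?\<Psi> X x0)) (dgm TYPE('f) k (mspace Y) (?\<Psi> Y y0))"
    unfolding dgm_pullback[OF R'(1,3) filt(1)] dgm_pullback[OF R'(1,4) filt(2)] .
  then show ?thesis
    unfolding cost_def
    by (rule bottleneck_dist_le_near[OF _ e])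
      (erule in_dgmD(3)[OF fin_metric_spacesD(1)[OF X]], erule in_dgmD(3)[OF fin_metric_spacesD(1)[OF Y]])
qed

theorem theorem5p9:
  fixes \<nu> :: "('n::finite) dist_matrix set \<Rightarrow> real ^ 'l \<Rightarrow> real"
    and \<rho> :: "'a metric \<Rightarrow> 'a \<Rightarrow> real ^ 'l"
    and L K :: real
    and \<Psi> :: "'a basepoint_functor"
  assumes "L \<ge> 0" and "K \<ge> 0"
    and "adjusted_valuation \<nu>" and "stable_valuation L \<nu>"
    and "stable_descriptor K \<rho>"
    and "\<Psi> = local_functor \<nu> \<rho>"
  shows "\<forall>k. \<forall>X \<in> fin_metric_spaces. \<forall>Y \<in> fin_metric_spaces.
     (MIN R \<in> correspondences X Y. MAX (x0, y0) \<in> R. cost TYPE('f::field) \<Psi> k X Y x0 y0)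
       \<le> ereal (2 * L * max 1 K * gh_dist X Y)"
proof (intro allI ballI)
  fix k and X Y :: "'a metric"
  assume X: "X \<in> fin_metric_spaces" and Y: "Y \<in> fin_metric_spaces"
  let ?c = "\<lambda>R. MAX (x0, y0) \<in> R. cost TYPE('f) \<Psi> k X Y x0 y0"
  note fin = finite_correspondences[OF X Y]
  \<comment> \<open>The minimum is attained, so there is a correspondence whose distortion is
    exactly twice \<open>gh_dist X Y\<close>.\<close>
  have "Min (distortion X Y ` correspondences X Y) \<in> distortion X Y ` correspondences X Y"
    using fin by (intro Min_in) auto
  then obtain R where R: "R \<in> correspondences X Y" "distortion X Y R = 2 * gh_dist X Y"
    by (auto simp: gh_dist_def)
  have "Min (?c ` correspondences X Y) \<le> ?c R"
    using fin R(1) by (intro Min_le) auto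
  also have "\<dots> \<le> ereal (L * max 1 K * distortion X Y R)"
  proof (rule Max.boundedI)
    fix c assume "c \<in> (\<lambda>(x0, y0). cost TYPE('f) \<Psi> k X Y x0 y0) ` R"
    then obtain x0 y0 where "(x0, y0) \<in> R" "c = cost TYPE('f) \<Psi> k X Y x0 y0" by auto
    then show "c \<le> ereal (L * max 1 K * distortion X Y R)"
      using cost_local_functor_le[OF assms(1,3-5) X Y R(1)] assms(6) by simp
  qed (use correspondenceD[OF X Y R(1)] in auto)
  also have "L * max 1 K * distortion X Y R = 2 * L * max 1 K * gh_dist X Y"
    by (simp add: R(2))
  finally show "Min (?c ` correspondences X Y) \<le> ereal (2 * L * max 1 K * gh_dist X Y)" .
qed

end
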